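(* Let $\kappa_1$ be an admissible sequence of polynomial growth and let $\kappa_2$ be an admissible sequence of exponential growth. Then: 1. There exists a non-trivial (i.e. non-zero) $Q(\mathbf{1})$-valued trace on $Q(\kappa_1)$. 2. There is no non-trivial trace on $Q(\kappa_2)$.
   Context: Matrix algebras: for $k\in\mathbb{N}$, $M_k$ is the $C^*$-algebra of $k\times k$ complex matrices; $M_\infty$ denotes the $C^*$-algebra of compact operators on a separable infinite-dimensional Hilbert space with a fixed orthonormal basis. For $k\le l\le\infty$, $M_k\subset M_l$ is the natural inclusion (operators supported on the first $k$ coordinates). An admissible sequence is a non-decreasing function $\kappa:\mathbb{N}\to\mathbb{N}\cup\{\infty\}$ which either stabilizes or approaches infinity. $B(\kappa)$ is the $C^*$-algebra of all bounded sequences $(m_1,m_2,\ldots)$ with $m_i\in M_{\kappa(i)}$ and $\lim_{i\to\infty}\|m_{i+1}-m_i\|=0$; $I(\kappa)\subset B(\kappa)$ is the ideal of sequences converging to zero in norm; $Q(\kappa)=B(\kappa)/I(\kappa)$. $Q(\mathbf{1})$ is $Q(\kappa)$ for the constant sequence $\kappa\equiv 1$; it is a commutative $C^*$-algebra. $\kappa$ has polynomial growth if there exist numbers $0<C_1<C_2$ and $n\ge 1$ such that $C_1 i^n\le\kappa(i)\le C_2 i^n$ for all $i$ and $\lim_{i\to\infty}\frac{\kappa(i+1)-\kappa(i)}{i^n}=0$. $\kappa$ has exponential growth if there exists $a>1$ such that $\kappa(i+1)\ge a\,\kappa(i)$ for all $i$. For a commutative $C^*$-algebra $D$, a $D$-valued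 trace on a $C^*$-algebra $A$ is an (everywhere defined) positive linear map $\tau:A\to D$ with $\tau(ab)=\tau(ba)$ for all $a,b\in A$; a trace (without qualification) is a $\mathbb{C}$-valued trace. *)

theory Defs
  imports "HOL-Analysis.Analysis"
begin

section \<open>The Hilbert space of square-summable sequences\<close>

typedef ell2 = "{x :: nat \<Rightarrow> complex. summable (\<lambda>n. (cmod (x n))\<^sup>2)}"
  morphisms coord Abs_ell2
  by (rule exI[of _ "\<lambda>_. 0"]) simp

setup_lifting type_definition_ell2

lemma coord_summable_sq: "summable (\<lambda>n. (cmod (coord x n))\<^sup>2)"
  using coord by blast

lemma summable_cmod_mult:
  assumes "summable (\<lambda>n. (cmod (x n))\<^sup>2)" "summable (\<lambda>n. (cmod (y n))\<^sup>2)"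
  shows "summable (\<lambda>n. cmod (x n) * cmod (y n))"
proof (rule summable_comparison_test')
  show "summable (\<lambda>n. (cmod (x n))\<^sup>2 + (cmod (y n))\<^sup>2)"
    using assms by (rule summable_add)
  fix n :: nat
  have "2 * (cmod (x n) * cmod (y n)) \<le> (cmod (x n))\<^sup>2 + (cmod (y n))\<^sup>2"
    using sum_squares_bound[of "cmod (x n)" "cmod (y n)"] by simp
  moreover have "0 \<le> cmod (x n) * cmod (y n)" by simp
  ultimately show "norm (cmod (x n) * cmod (y n)) \<le> (cmod (x n))\<^sup>2 + (cmod (y n))\<^sup>2"
    unfolding real_norm_def by linarith
qed

lemma ell2_add_closed:
  assumes "summable (\<lambda>n. (cmod (x n))\<^sup>2)" "summable (\<lambda>n. (cmod (y n))\<^sup>2)"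
  shows "summable (\<lambda>n. (cmod (x n + y n))\<^sup>2)"
proof (rule summable_comparison_test')
  show "summable (\<lambda>n. (cmod (x n))\<^sup>2 + 2 * (cmod (x n) * cmod (y n)) + (cmod (y n))\<^sup>2)"
    by (intro summable_add summable_mult summable_cmod_mult assms)
  fix n :: nat
  have "(cmod (x n + y n))\<^sup>2 \<le> (cmod (x n) + cmod (y n))\<^sup>2"
    by (intro power_mono norm_triangle_ineq) simp
  then show "norm ((cmod (x n + y n))\<^sup>2)
      \<le> (cmod (x n))\<^sup>2 + 2 * (cmod (x n) * cmod (y n)) + (cmod (y n))\<^sup>2"
    by (simp add: power2_sum)
qed

lemma ell2_scale_closed:
  assumes "summable (\<lambda>n. (cmod (x n))\<^sup>2)"
  shows "summable (\<lambda>n. (cmod (c * x n))\<^sup>2)"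
  using summable_mult[OF assms, of "(cmod c)\<^sup>2"] by (simp add: norm_mult power_mult_distrib)

lift_definition scaleC :: "complex \<Rightarrow> ell2 \<Rightarrow> ell2" is "\<lambda>c x n. c * x n"
  by (rule ell2_scale_closed)

lift_definition basis_vec :: "nat \<Rightarrow> ell2" is "\<lambda>k n. if n = k then 1 else 0"
proof -
  fix k :: nat
  show "summable (\<lambda>n. (cmod (if n = k then 1 else 0))\<^sup>2)"
    by (rule summable_finite[of "{k}"]) auto
qed

text \<open>Conjugate-linear in the first argument.\<close>

definition cinner :: "ell2 \<Rightarrow> ell2 \<Rightarrow> complex" where
  "cinner x y = (\<Sum>n. cnj (coord x n) * coord y n)"

lemma summable_cinner: "summable (\<lambda>n. cnj (coord x n) * coord y n)"
  by (rule summable_norm_cancel)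
     (simp add: norm_mult summable_cmod_mult coord_summable_sq)

instantiation ell2 :: real_inner
begin

lift_definition zero_ell2 :: ell2 is "\<lambda>_. 0" by simp
lift_definition plus_ell2 :: "ell2 \<Rightarrow> ell2 \<Rightarrow> ell2" is "\<lambda>x y n. x n + y n"
  by (rule ell2_add_closed)
lift_definition uminus_ell2 :: "ell2 \<Rightarrow> ell2" is "\<lambda>x n. - x n" by simp
lift_definition minus_ell2 :: "ell2 \<Rightarrow> ell2 \<Rightarrow> ell2" is "\<lambda>x y n. x n - y n"
proof -
  fix x y :: "nat \<Rightarrow> complex"
  assume "summable (\<lambda>n. (cmod (x n))\<^sup>2)" "summable (\<lambda>n. (cmod (y n))\<^sup>2)"
  then show "summable (\<lambda>n. (cmod (x n - y n))\<^sup>2)"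
    using ell2_add_closed[of x "\<lambda>n. - y n"] by simp
qed
lift_definition scaleR_ell2 :: "real \<Rightarrow> ell2 \<Rightarrow> ell2" is "\<lambda>c x n. complex_of_real c * x n"
  by (rule ell2_scale_closed)

definition inner_ell2 :: "ell2 \<Rightarrow> ell2 \<Rightarrow> real" where
  "inner_ell2 x y = Re (cinner x y)"
definition norm_ell2 :: "ell2 \<Rightarrow> real" where
  "norm_ell2 x = sqrt (inner x x)"
definition sgn_ell2 :: "ell2 \<Rightarrow> ell2" where
  "sgn_ell2 x = inverse (norm x) *\<^sub>R x"
definition dist_ell2 :: "ell2 \<Rightarrow> ell2 \<Rightarrow> real" where
  "dist_ell2 x y = norm (x - y)"
definition uniformity_ell2 :: "(ell2 \<times> ell2) filter" where
  "uniformity_ell2 = (INF e\<in>{0<..}. principal {(x, y). dist x y < e})"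
definition open_ell2 :: "ell2 set \<Rightarrow> bool" where
  "open_ell2 U = (\<forall>x\<in>U. eventually (\<lambda>(x', y). x' = x \<longrightarrow> y \<in> U) uniformity)"

instance
proof
  fix x y z :: ell2 and a b :: real and U :: "ell2 set"
  show "x + y + z = x + (y + z)" by transfer (simp add: add.assoc)
  show "x + y = y + x" by transfer (simp add: add.commute)
  show "0 + x = x" by transfer simp
  show "- x + x = 0" by transfer simp
  show "x - y = x + - y" by transfer simp
  show "a *\<^sub>R (x + y) = a *\<^sub>R x + a *\<^sub>R y" by transfer (simp add: distrib_left)
  show "(a + b) *\<^sub>R x = a *\<^sub>R x + b *\<^sub>R x" by transfer (simp add: distrib_right)
  show "a *\<^sub>R b *\<^sub>R x = (a * b) *\<^sub>R x" by transfer (simp add: mult.assoc)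
  show "1 *\<^sub>R x = x" by transfer simp
  show "sgn x = inverse (norm x) *\<^sub>R x" by (rule sgn_ell2_def)
  show "dist x y = norm (x - y)" by (rule dist_ell2_def)
  show "uniformity = (INF e\<in>{0<..}. principal {(x :: ell2, y). dist x y < e})"
    by (rule uniformity_ell2_def)
  show "open U = (\<forall>x\<in>U. eventually (\<lambda>(x', y). x' = x \<longrightarrow> y \<in> U) uniformity)"
    by (rule open_ell2_def)
  show "norm x = sqrt (inner x x)" by (rule norm_ell2_def)
  have re: "inner u v = (\<Sum>n. Re (cnj (coord u n) * coord v n))"
    and re_sum: "summable (\<lambda>n. Re (cnj (coord u n) * coord v n))" for u v :: ell2
    unfolding inner_ell2_def cinner_def
    using summable_cinner[of u v] by (simp_all only: Re_suminf summable_Re)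
  show "inner x y = inner y x"
    unfolding re by (simp add: mult.commute)
  show "inner (x + y) z = inner x z + inner y z"
    unfolding re suminf_add[OF re_sum re_sum]
    by (rule arg_cong[where f = suminf]) (auto simp: plus_ell2.rep_eq algebra_simps)
  show "inner (a *\<^sub>R x) y = a * inner x y"
    unfolding re suminf_mult[OF re_sum, symmetric]
    by (rule arg_cong[where f = suminf]) (auto simp: scaleR_ell2.rep_eq algebra_simps)
  have sq: "Re (cnj (coord x n) * coord x n) = (cmod (coord x n))\<^sup>2" for n
    unfolding cmod_power2 by (simp add: power2_eq_square)
  show "0 \<le> inner x x"
    unfolding re sq by (rule suminf_nonneg[OF coord_summable_sq]) simp
  have "inner x x = 0 \<longleftrightarrow> (\<forall>n. coord x n = 0)"
    unfolding re sq by (subst suminf_eq_zero_iff[OF coord_summable_sq]) auto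
  also have "\<dots> \<longleftrightarrow> x = 0"
    by (metis coord_inject ext zero_ell2.rep_eq)
  finally show "inner x x = 0 \<longleftrightarrow> x = 0" .
qed

end

section \<open>Compact operators and the matrix algebras\<close>

text \<open>The norm of \<^typ>\<open>ell2 \<Rightarrow>\<^sub>L ell2\<close> is the operator norm; its elements are only real-linear,
  so complex linearity is imposed separately.\<close>

definition complex_linear :: "(ell2 \<Rightarrow>\<^sub>L ell2) \<Rightarrow> bool" where
  "complex_linear T \<longleftrightarrow> (\<forall>c x. blinfun_apply T (scaleC c x) = scaleC c (blinfun_apply T x))"

definition compact_operator :: "(ell2 \<Rightarrow>\<^sub>L ell2) \<Rightarrow> bool" where
  "compact_operator T \<longleftrightarrow> compact (closure (blinfun_apply T ` cball 0 1))"

definition op_scale :: "complex \<Rightarrow> (ell2 \<Rightarrow>\<^sub>L ell2) \<Rightarrow> (ell2 \<Rightarrow>\<^sub>L ell2)" where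
  "op_scale c T = Blinfun (\<lambda>x. scaleC c (blinfun_apply T x))"

definition op_adj :: "(ell2 \<Rightarrow>\<^sub>L ell2) \<Rightarrow> (ell2 \<Rightarrow>\<^sub>L ell2)" where
  "op_adj T = (THE S. \<forall>x y. cinner (blinfun_apply S x) y = cinner x (blinfun_apply T y))"

definition matrix_entry :: "(ell2 \<Rightarrow>\<^sub>L ell2) \<Rightarrow> nat \<Rightarrow> nat \<Rightarrow> complex" where
  "matrix_entry T i j = cinner (basis_vec i) (blinfun_apply T (basis_vec j))"

text \<open>The basis vectors are numbered from 0, so \<open>mat_alg k\<close> consists of the operators supported on
  the coordinates \<open>i < k\<close>, and \<open>mat_alg \<infinity>\<close> of all compact operators.\<close>

definition mat_alg :: "enat \<Rightarrow> (ell2 \<Rightarrow>\<^sub>L ell2) set" where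
  "mat_alg k = {T. complex_linear T \<and> compact_operator T \<and>
             (\<forall>i j. matrix_entry T i j \<noteq> 0 \<longrightarrow> enat i < k \<and> enat j < k)}"

section \<open>Star-algebras, quotients and traces\<close>

text \<open>Only the *-algebra structure of a C*-algebra is recorded, because traces do not refer to the
  norm. There is no unit, since the algebras below need not have one.\<close>

record 'a star_algebra =
  carrier :: "'a set"
  zero :: 'a
  add :: "'a \<Rightarrow> 'a \<Rightarrow> 'a"
  mult :: "'a \<Rightarrow> 'a \<Rightarrow> 'a"
  scale :: "complex \<Rightarrow> 'a \<Rightarrow> 'a"
  star :: "'a \<Rightarrow> 'a"

definition complex_algebra :: "complex star_algebra" where
  "complex_algebra = \<lparr>carrier = UNIV, zero = 0, add = (+), mult = (*), scale = (*), star = cnj\<rparr>"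

definition ideal_coset :: "'a star_algebra \<Rightarrow> 'a set \<Rightarrow> 'a \<Rightarrow> 'a set" where
  "ideal_coset A I x = {add A x z | z. z \<in> I}"

definition quotient_algebra :: "'a star_algebra \<Rightarrow> 'a set \<Rightarrow> 'a set star_algebra" where
  "quotient_algebra A I =
     \<lparr>carrier = ideal_coset A I ` carrier A,
      zero = I,
      add = (\<lambda>X Y. \<Union>x\<in>X. \<Union>y\<in>Y. ideal_coset A I (add A x y)),
      mult = (\<lambda>X Y. \<Union>x\<in>X. \<Union>y\<in>Y. ideal_coset A I (mult A x y)),
      scale = (\<lambda>c X. \<Union>x\<in>X. ideal_coset A I (scale A c x)),
      star = (\<lambda>X. \<Union>x\<in>X. ideal_coset A I (star A x))\<rparr>"

definition positive_element :: "'a star_algebra \<Rightarrow> 'a \<Rightarrow> bool" where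
  "positive_element A x \<longleftrightarrow> (\<exists>y\<in>carrier A. x = mult A (star A y) y)"

definition valued_trace :: "'d star_algebra \<Rightarrow> 'a star_algebra \<Rightarrow> ('a \<Rightarrow> 'd) \<Rightarrow> bool" where
  "valued_trace D A \<tau> \<longleftrightarrow>
     (\<forall>x\<in>carrier A. \<tau> x \<in> carrier D) \<and>
     (\<forall>x\<in>carrier A. \<forall>y\<in>carrier A. \<tau> (add A x y) = add D (\<tau> x) (\<tau> y)) \<and>
     (\<forall>c. \<forall>x\<in>carrier A. \<tau> (scale A c x) = scale D c (\<tau> x)) \<and>
     (\<forall>x\<in>carrier A. positive_element A x \<longrightarrow> positive_element D (\<tau> x)) \<and>
     (\<forall>x\<in>carrier A. \<forall>y\<in>carrier A. \<tau> (mult A x y) = \<tau> (mult A y x))"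

abbreviation scalar_trace :: "'a star_algebra \<Rightarrow> ('a \<Rightarrow> complex) \<Rightarrow> bool" where
  "scalar_trace \<equiv> valued_trace complex_algebra"

definition nontrivial_map :: "'d star_algebra \<Rightarrow> 'a star_algebra \<Rightarrow> ('a \<Rightarrow> 'd) \<Rightarrow> bool" where
  "nontrivial_map D A \<tau> \<longleftrightarrow> (\<exists>x\<in>carrier A. \<tau> x \<noteq> zero D)"

section \<open>Admissible sequences and their algebras\<close>

text \<open>Sequences are indexed by \<open>1, 2, \<dots>\<close>; the value of \<open>\<kappa>\<close> at \<open>0\<close> is irrelevant, and the
  entry at \<open>0\<close> of a sequence of operators is fixed to be \<open>0\<close>.\<close>

definition admissible :: "(nat \<Rightarrow> enat) \<Rightarrow> bool" where
  "admissible \<kappa> \<longleftrightarrow>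
     (\<forall>i\<ge>1. 1 \<le> \<kappa> i) \<and> mono_on {1..} \<kappa> \<and>
     ((\<exists>N. \<exists>c. \<forall>i\<ge>N. \<kappa> i = c) \<or> \<kappa> \<longlonglongrightarrow> \<infinity>)"

definition polynomial_growth :: "(nat \<Rightarrow> enat) \<Rightarrow> bool" where
  "polynomial_growth \<kappa> \<longleftrightarrow>
     (\<exists>C1 C2 n :: real. 0 < C1 \<and> C1 < C2 \<and> 1 \<le> n \<and>
        (\<forall>i\<ge>1. ereal (C1 * real i powr n) \<le> ereal_of_enat (\<kappa> i) \<and>
               ereal_of_enat (\<kappa> i) \<le> ereal (C2 * real i powr n)) \<and>
        (\<lambda>i. (ereal_of_enat (\<kappa> (i + 1)) - ereal_of_enat (\<kappa> i)) / ereal (real i powr n))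
          \<longlonglongrightarrow> 0)"

definition exponential_growth :: "(nat \<Rightarrow> enat) \<Rightarrow> bool" where
  "exponential_growth \<kappa> \<longleftrightarrow>
     (\<exists>a :: real. 1 < a \<and>
        (\<forall>i\<ge>1. ereal a * ereal_of_enat (\<kappa> i) \<le> ereal_of_enat (\<kappa> (i + 1))))"

definition slow_seq :: "(nat \<Rightarrow> enat) \<Rightarrow> (nat \<Rightarrow> ell2 \<Rightarrow>\<^sub>L ell2) star_algebra" where
  "slow_seq \<kappa> =
     \<lparr>carrier = {m. m 0 = 0 \<and> (\<forall>i\<ge>1. m i \<in> mat_alg (\<kappa> i)) \<and> bounded (range m) \<and>
                    (\<lambda>i. norm (m (i + 1) - m i)) \<longlonglongrightarrow> 0},
      zero = (\<lambda>i. 0),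
      add = (\<lambda>m m' i. m i + m' i),
      mult = (\<lambda>m m' i. m i o\<^sub>L m' i),
      scale = (\<lambda>c m i. op_scale c (m i)),
      star = (\<lambda>m i. op_adj (m i))\<rparr>"

definition null_ideal :: "(nat \<Rightarrow> enat) \<Rightarrow> (nat \<Rightarrow> ell2 \<Rightarrow>\<^sub>L ell2) set" where
  "null_ideal \<kappa> = {m \<in> carrier (slow_seq \<kappa>). (\<lambda>i. norm (m i)) \<longlonglongrightarrow> 0}"

definition slow_quot :: "(nat \<Rightarrow> enat) \<Rightarrow> (nat \<Rightarrow> ell2 \<Rightarrow>\<^sub>L ell2) set star_algebra" where
  "slow_quot \<kappa> = quotient_algebra (slow_seq \<kappa>) (null_ideal \<kappa>)"

end

theory Submission
  imports Defs
begin

text \<open>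
  \<^bold>\<open>Polynomial growth.\<close> The trace is the normalised matrix trace, taken level by level: a slow
  sequence \<open>x\<close> goes to the scalar sequence \<open>Tr (x i) / \<kappa> i\<close>.  Passing from level \<open>i\<close> to level
  \<open>i + 1\<close> changes this scalar in two ways.  Replacing \<open>x i\<close> by \<open>x (i + 1)\<close> costs at most the norm of
  the increment, and replacing the denominator costs at most the relative jump
  \<open>(\<kappa> (i + 1) - \<kappa> i) / \<kappa> (i + 1)\<close>, which tends to zero because the jump is small compared with
  \<open>i\<^sup>n\<close> while \<open>\<kappa> (i + 1)\<close> is at least a multiple of \<open>i\<^sup>n\<close>.  So the scalar sequence
  is slow again (\<open>norm_trace_slow\<close>).  Positivity survives in the quotient because square roots of non-negative slow scalar sequences are slow.  The trace is not
  zero: the averages of the unit matrices of the first \<open>i\<close> levels form a slow sequence whose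
  normalised trace stays away from zero, since the upper half of the levels up to \<open>i\<close> all have
  size comparable to \<open>\<kappa> i\<close> (\<open>norm_trace_ramp_not_null\<close>).

  \<^bold>\<open>Exponential growth.\<close> Additivity and the trace property force a trace to vanish, as follows.  Let
  \<open>\<kappa> (i + K) \<ge> 2 \<kappa> i\<close> for all \<open>i\<close>.  The isometries \<open>e\<^sub>j \<mapsto> e\<^sub>2\<^sub>j\<close> and \<open>e\<^sub>j \<mapsto> e\<^sub>2\<^sub>j\<^sub>+\<^sub>1\<close> place two orthogonal copies of the level-\<open>i\<close> algebra
  inside the level-\<open>(i + K)\<close> algebra.  A slow sequence differs from its \<open>K\<close>-step delay by a null
  sequence, so \<open>x\<close> is equivalent, for the trace, to either copy of its own delay
  (\<open>tracial_conj_interleave\<close>).  Writing \<open>\<Phi>\<close> for the delayed sum of both copies, any additive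
  tracial \<open>t\<close> therefore satisfies \<open>t (\<Phi> y) = 2 t y\<close>.  Since \<open>\<Phi>\<close> does not increase the norm, the
  equation \<open>2 y = x + \<Phi> y\<close> has a slow solution (\<open>amplify_slow\<close>), and
  \<open>2 t y = t x + 2 t y\<close> forces \<open>t x = 0\<close>.

  The isometries do not lie in the algebra, so moving them around a trace requires each slow
  sequence to be a product of two slow sequences up to a null sequence.  As the unit matrices do not
  vary slowly, this uses a slowly varying approximate unit adapted to the given sequence
  (\<open>slow_approx_unit\<close>).
\<close>

section \<open>Coordinates in the sequence space\<close>

lemmas coord_simps =
  zero_ell2.rep_eq plus_ell2.rep_eq uminus_ell2.rep_eq minus_ell2.rep_eq
  scaleR_ell2.rep_eq scaleC.rep_eq basis_vec.rep_eq

lemma ell2_eqI: "(\<And>n. coord x n = coord y n) \<Longrightarrow> x = y"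
  by (metis coord_inject ext)

lemma coord_sum: "coord (sum f A) n = (\<Sum>a\<in>A. coord (f a) n)"
  by (induction A rule: infinite_finite_induct) (auto simp: coord_simps)

lemma norm_ell2_sq: "(norm x)\<^sup>2 = (\<Sum>n. (cmod (coord x n))\<^sup>2)"
proof -
  have "(norm x)\<^sup>2 = Re (\<Sum>n. cnj (coord x n) * coord x n)"
    by (simp add: power2_norm_eq_inner inner_ell2_def cinner_def)
  also have "\<dots> = (\<Sum>n. Re (cnj (coord x n) * coord x n))"
    by (rule Re_suminf[OF summable_cinner])
  also have "\<dots> = (\<Sum>n. (cmod (coord x n))\<^sup>2)"
    by (intro suminf_cong) (simp only: cmod_power2, simp add: power2_eq_square)
  finally show ?thesis .
qed

lemma cmod_coord_le: "cmod (coord x n) \<le> norm x"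
proof -
  have "(\<Sum>k\<in>{n}. (cmod (coord x k))\<^sup>2) \<le> (norm x)\<^sup>2"
    unfolding norm_ell2_sq by (rule sum_le_suminf[OF coord_summable_sq]) auto
  then show ?thesis by (simp add: abs_le_square_iff[symmetric])
qed

lemma norm_ell2_mono:
  assumes "\<And>n. cmod (coord x n) \<le> cmod (coord y n)"
  shows "norm x \<le> norm y"
proof -
  have "(norm x)\<^sup>2 \<le> (norm y)\<^sup>2"
    unfolding norm_ell2_sq
    by (rule suminf_le) (use assms in \<open>auto intro: power_mono coord_summable_sq\<close>)
  then show ?thesis by (simp add: abs_le_square_iff[symmetric])
qed

lemma bounded_linear_coord: "bounded_linear (\<lambda>x. coord x n)"
  by (rule bounded_linear_intro[where K = 1])
     (auto simp: coord_simps cmod_coord_le scaleR_conv_of_real)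

lemma scaleC_add_right: "scaleC c (x + y) = scaleC c x + scaleC c y"
  by (rule ell2_eqI) (simp add: coord_simps algebra_simps)

lemma scaleC_add_left: "scaleC (c + d) x = scaleC c x + scaleC d x"
  by (rule ell2_eqI) (simp add: coord_simps algebra_simps)

lemma scaleC_scaleR: "scaleC c (r *\<^sub>R x) = r *\<^sub>R scaleC c x"
  by (rule ell2_eqI) (simp add: coord_simps)

lemma scaleC_of_real: "scaleC (complex_of_real r) x = r *\<^sub>R x"
  by (rule ell2_eqI) (simp add: coord_simps)

lemma scaleC_scaleC: "scaleC c (scaleC d x) = scaleC (c * d) x"
  by (rule ell2_eqI) (simp add: coord_simps)

lemma scaleC_zero [simp]: "scaleC 0 x = 0" "scaleC c 0 = 0"
  by (rule ell2_eqI, simp add: coord_simps)+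

lemma norm_scaleC: "norm (scaleC c x) = cmod c * norm x"
proof -
  have "(norm (scaleC c x))\<^sup>2 = (cmod c * norm x)\<^sup>2"
    unfolding norm_ell2_sq power_mult_distrib suminf_mult[OF coord_summable_sq, symmetric]
    by (simp add: coord_simps norm_mult power_mult_distrib)
  then show ?thesis by simp
qed

lemma bounded_linear_scaleC_right: "bounded_linear (scaleC c)"
  by (rule bounded_linear_intro[where K = "cmod c"])
     (auto simp: scaleC_add_right scaleC_scaleR norm_scaleC)

lemma bounded_linear_scaleC_left: "bounded_linear (\<lambda>c. scaleC c x)"
  by (rule bounded_linear_intro[where K = "norm x"])
     (auto simp: scaleC_add_left norm_scaleC scaleR_conv_of_real scaleC_of_real
        simp flip: scaleC_scaleC)

lemma cinner_commute: "cinner y x = cnj (cinner x y)"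
proof -
  have "(\<lambda>n. cnj (cnj (coord x n) * coord y n)) sums cnj (cinner x y)"
    unfolding cinner_def by (subst sums_cnj) (rule summable_sums[OF summable_cinner])
  then show ?thesis
    by (simp add: cinner_def sums_iff mult.commute)
qed

lemma cinner_add_right: "cinner x (y + z) = cinner x y + cinner x z"
  unfolding cinner_def suminf_add[OF summable_cinner summable_cinner]
  by (simp add: coord_simps algebra_simps)

lemma cinner_scaleC_right: "cinner x (scaleC c y) = c * cinner x y"
  unfolding cinner_def suminf_mult[OF summable_cinner, symmetric]
  by (simp add: coord_simps algebra_simps)

lemma cinner_add_left: "cinner (x + y) z = cinner x z + cinner y z"
  by (metis cinner_commute cinner_add_right complex_cnj_add)

lemma cinner_scaleC_left: "cinner (scaleC c x) y = cnj c * cinner x y"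
  by (metis cinner_commute cinner_scaleC_right complex_cnj_mult)

lemma cinner_zero [simp]: "cinner x 0 = 0" "cinner 0 x = 0"
  by (simp_all add: cinner_def coord_simps)

lemma cinner_sum_right: "cinner x (sum f A) = (\<Sum>a\<in>A. cinner x (f a))"
  by (induction A rule: infinite_finite_induct) (auto simp: cinner_add_right)

lemma cinner_sum_left: "cinner (sum f A) x = (\<Sum>a\<in>A. cinner (f a) x)"
  by (induction A rule: infinite_finite_induct) (auto simp: cinner_add_left)

lemma cinner_basis_left: "cinner (basis_vec i) y = coord y i"
proof -
  have "cinner (basis_vec i) y = (\<Sum>n\<in>{i}. cnj (coord (basis_vec i) n) * coord y n)"
    unfolding cinner_def by (rule suminf_finite) (auto simp: coord_simps)
  then show ?thesis by (simp add: coord_simps)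
qed

lemma cinner_basis_right: "cinner x (basis_vec i) = cnj (coord x i)"
  by (metis cinner_basis_left cinner_commute)

lemma cinner_self: "cinner x x = complex_of_real ((norm x)\<^sup>2)"
proof (rule complex_eqI)
  show "Re (cinner x x) = Re (complex_of_real ((norm x)\<^sup>2))"
    by (simp add: power2_norm_eq_inner inner_ell2_def)
  show "Im (cinner x x) = Im (complex_of_real ((norm x)\<^sup>2))"
    using arg_cong[OF cinner_commute[of x x], of Im] by simp
qed

lemma norm_basis_vec [simp]: "norm (basis_vec i) = 1"
proof -
  have "complex_of_real ((norm (basis_vec i))\<^sup>2) = 1"
    unfolding cinner_self[symmetric] cinner_basis_left by (simp add: coord_simps)
  then have "(norm (basis_vec i))\<^sup>2 = 1" using of_real_eq_1_iff by blast
  then show ?thesis by (simp add: power2_eq_1_iff) (metis norm_ge_zero not_one_le_zero neg_0_le_iff_le zero_le_one)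
qed

text \<open>The real Cauchy-Schwarz inequality bounds the real part directly, and the imaginary part after
  rotating the first argument by \<open>\<i>\<close>.  The resulting factor 2 is not sharp, but only continuity
  matters below.\<close>

lemma bounded_linear_cinner_right: "bounded_linear (cinner u)"
proof (rule bounded_linear_intro[where K = "2 * norm u"])
  fix x y :: ell2 and r :: real
  show "cinner u (x + y) = cinner u x + cinner u y" by (rule cinner_add_right)
  show "cinner u (r *\<^sub>R x) = r *\<^sub>R cinner u x"
    by (simp add: cinner_scaleC_right scaleR_conv_of_real flip: scaleC_of_real)
  have "\<bar>Re (cinner u x)\<bar> \<le> norm u * norm x"
    using Cauchy_Schwarz_ineq2[of u x] by (simp add: inner_ell2_def)
  moreover have "\<bar>Im (cinner u x)\<bar> \<le> norm u * norm x"
    using Cauchy_Schwarz_ineq2[of "scaleC \<i> u" x]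
    by (simp add: inner_ell2_def cinner_scaleC_left norm_scaleC)
  ultimately show "norm (cinner u x) \<le> norm x * (2 * norm u)"
    using cmod_le[of "cinner u x"] by (simp add: algebra_simps)
qed

section \<open>Rank-one operators and coordinate projections\<close>

lift_definition rank_one :: "ell2 \<Rightarrow> ell2 \<Rightarrow> (ell2 \<Rightarrow>\<^sub>L ell2)" is
  "\<lambda>u v x. scaleC (cinner u x) v"
  by (rule bounded_linear_compose[OF bounded_linear_scaleC_left bounded_linear_cinner_right])

definition coord_proj :: "nat \<Rightarrow> (ell2 \<Rightarrow>\<^sub>L ell2)" where
  "coord_proj n = (\<Sum>j<n. rank_one (basis_vec j) (basis_vec j))"

lemma blinfun_sum_apply: "blinfun_apply (sum f A) x = (\<Sum>a\<in>A. blinfun_apply (f a) x)"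
  by (simp add: blinfun.sum_left)

lemma coord_proj_apply:
  "blinfun_apply (coord_proj n) x = (\<Sum>j<n. scaleC (coord x j) (basis_vec j))"
  by (simp add: coord_proj_def blinfun_sum_apply rank_one.rep_eq cinner_basis_left)

lemma coord_coord_proj: "coord (coord_proj n x) i = (if i < n then coord x i else 0)"
  by (simp add: coord_proj_apply coord_sum coord_simps if_distrib cong: if_cong)

lemma norm_coord_proj_le: "norm (coord_proj n) \<le> 1"
  by (rule norm_blinfun_bound) (auto intro!: norm_ell2_mono simp: coord_coord_proj)

lemma norm_coord_proj_compl_le: "norm (coord_proj n x - x) \<le> norm x"
  by (auto intro!: norm_ell2_mono simp: coord_coord_proj coord_simps)

lemma coord_proj_tendsto: "(\<lambda>n. coord_proj n x) \<longlonglongrightarrow> x"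
proof -
  let ?f = "\<lambda>n. (cmod (coord x n))\<^sup>2"
  have sq: "(norm (coord_proj n x - x))\<^sup>2 = (\<Sum>i. ?f (i + n))" for n
  proof -
    have "(norm (coord_proj n x - x))\<^sup>2 = (\<Sum>i. if i < n then 0 else ?f i)"
      unfolding norm_ell2_sq by (intro suminf_cong) (auto simp: coord_coord_proj coord_simps)
    also have "\<dots> = (\<Sum>i. if i + n < n then 0 else ?f (i + n))"
    proof -
      have "summable (\<lambda>i. if i < n then 0 else ?f i)"
        by (rule summable_comparison_test'[OF coord_summable_sq[of x]]) auto
      from suminf_split_initial_segment[OF this, of n] show ?thesis by simp
    qed
    finally show ?thesis by simp
  qed
  have "(\<lambda>n. (norm (coord_proj n x - x))\<^sup>2) \<longlonglongrightarrow> 0"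
    unfolding sq by (rule suminf_exist_split2[OF coord_summable_sq])
  then have "(\<lambda>n. sqrt ((norm (coord_proj n x - x))\<^sup>2)) \<longlonglongrightarrow> sqrt 0"
    by (rule tendsto_real_sqrt)
  then have "(\<lambda>n. norm (coord_proj n x - x)) \<longlonglongrightarrow> 0" by simp
  then show ?thesis by (simp add: LIM_zero_iff tendsto_norm_zero_iff)
qed

section \<open>The matrix algebras as algebras\<close>

lemma complex_linear_compose:
  "complex_linear S \<Longrightarrow> complex_linear T \<Longrightarrow> complex_linear (S o\<^sub>L T)"
  by (simp add: complex_linear_def)

lemma complex_linear_rank_one: "complex_linear (rank_one u v)"
  by (simp add: complex_linear_def rank_one.rep_eq cinner_scaleC_right scaleC_scaleC)

lemma matrix_entry_eq: "matrix_entry T i j = coord (T (basis_vec j)) i"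
  by (simp add: matrix_entry_def cinner_basis_left)

lemma compact_closure_subset:
  fixes S :: "'a::metric_space set"
  shows "S \<subseteq> C \<Longrightarrow> compact C \<Longrightarrow> compact (closure S)"
  by (metis closed_closure closure_minimal compact_imp_closed compact_Int_closed inf.absorb_iff2)

text \<open>An operator is compact as soon as it maps the unit ball into some compact set, so closures need
  not be computed.\<close>

lemma compact_operatorI:
  "compact C \<Longrightarrow> (\<And>x. norm x \<le> 1 \<Longrightarrow> blinfun_apply T x \<in> C) \<Longrightarrow> compact_operator T"
  unfolding compact_operator_def by (rule compact_closure_subset[of _ C]) auto

lemma compact_operatorD:
  assumes "compact_operator T"
  obtains C where "compact C" "\<And>x. norm x \<le> 1 \<Longrightarrow> blinfun_apply T x \<in> C"
  using assms closure_subset unfolding compact_operator_def by (metis image_subset_iff mem_cball_0)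

lemma compact_operator_add:
  assumes "compact_operator S" "compact_operator T"
  shows "compact_operator (S + T)"
proof -
  obtain C where C: "compact C" "\<And>x. norm x \<le> 1 \<Longrightarrow> blinfun_apply S x \<in> C"
    using compact_operatorD[OF assms(1)] by blast
  obtain D where D: "compact D" "\<And>x. norm x \<le> 1 \<Longrightarrow> blinfun_apply T x \<in> D"
    using compact_operatorD[OF assms(2)] by blast
  show ?thesis
    by (rule compact_operatorI[OF compact_sums[OF C(1) D(1)]])
       (use C(2) D(2) in \<open>auto simp: blinfun.add_left\<close>)
qed

lemma compact_operator_compose_left:
  assumes "compact_operator T" shows "compact_operator (S o\<^sub>L T)"
proof -
  obtain C where C: "compact C" "\<And>x. norm x \<le> 1 \<Longrightarrow> blinfun_apply T x \<in> C"
    using compact_operatorD[OF assms] by blast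
  show ?thesis
  proof (rule compact_operatorI)
    show "compact (blinfun_apply S ` C)"
      by (rule compact_continuous_image[OF _ C(1)]) (auto intro: continuous_intros)
  qed (use C(2) in auto)
qed

lemma compact_operator_compose_right:
  assumes "compact_operator S" shows "compact_operator (S o\<^sub>L T)"
proof -
  obtain C where C: "compact C" "\<And>x. norm x \<le> 1 \<Longrightarrow> blinfun_apply S x \<in> C"
    using compact_operatorD[OF assms] by blast
  let ?r = "norm T + 1"
  have r: "?r > 0" using norm_ge_zero[of T] by linarith
  show ?thesis
  proof (rule compact_operatorI[OF compact_scaling[OF C(1), of ?r]])
    fix x :: ell2 assume x: "norm x \<le> 1"
    have "norm (T x) \<le> norm T * norm x" by (rule norm_blinfun)
    also have "\<dots> \<le> ?r" using x by (smt (verit) mult_left_le norm_ge_zero)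
    finally have "norm ((1 / ?r) *\<^sub>R T x) \<le> 1" using r by (simp add: divide_simps)
    then have "blinfun_apply S ((1 / ?r) *\<^sub>R T x) \<in> C" by (rule C(2))
    moreover have "(S o\<^sub>L T) x = ?r *\<^sub>R blinfun_apply S ((1 / ?r) *\<^sub>R T x)"
      using r by (simp add: blinfun.scaleR_right)
    ultimately show "(S o\<^sub>L T) x \<in> (*\<^sub>R) ?r ` C" by blast
  qed
qed

lemma compact_operator_rank_one: "compact_operator (rank_one u v)"
proof -
  obtain K where K: "\<And>x. norm (cinner u x) \<le> norm x * K" "K > 0"
    using bounded_linear.pos_bounded[OF bounded_linear_cinner_right] by blast
  show ?thesis
  proof (rule compact_operatorI)
    show "compact ((\<lambda>c. scaleC c v) ` cball 0 K)"
      by (rule compact_continuous_image)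
         (auto intro!: linear_continuous_on bounded_linear_scaleC_left)
    fix x :: ell2 assume "norm x \<le> 1"
    then have "norm (cinner u x) \<le> K"
      using K by (meson order_trans mult_left_le_one_le norm_ge_zero less_imp_le)
    then show "rank_one u v x \<in> (\<lambda>c. scaleC c v) ` cball 0 K"
      by (auto simp: rank_one.rep_eq)
  qed
qed

lemma mat_algI:
  assumes "complex_linear T" "compact_operator T"
    and "\<And>i j. coord (T (basis_vec j)) i \<noteq> 0 \<Longrightarrow> enat i < k \<and> enat j < k"
  shows "T \<in> mat_alg k"
  using assms by (auto simp: mat_alg_def matrix_entry_eq)

lemma mat_alg_linear: "T \<in> mat_alg k \<Longrightarrow> blinfun_apply T (scaleC c x) = scaleC c (T x)"
  by (simp add: mat_alg_def complex_linear_def)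

lemma mat_alg_compact: "T \<in> mat_alg k \<Longrightarrow> compact_operator T"
  by (simp add: mat_alg_def)

lemma mat_alg_basis_zero: "T \<in> mat_alg k \<Longrightarrow> \<not> enat j < k \<Longrightarrow> T (basis_vec j) = 0"
  by (rule ell2_eqI) (auto simp: mat_alg_def matrix_entry_eq coord_simps)

lemma complex_linear_coord_proj_expand:
  assumes "complex_linear T"
  shows "blinfun_apply T (coord_proj n x) = (\<Sum>j<n. scaleC (coord x j) (T (basis_vec j)))"
  using assms by (simp add: coord_proj_apply blinfun.sum_right complex_linear_def)

text \<open>By continuity, a vanishing row of the matrix gives a vanishing coordinate on the whole
  range, not only on the images of the basis vectors.\<close>

lemma mat_alg_coord_zero:
  assumes "T \<in> mat_alg k" "\<not> enat i < k"
  shows "coord (T x) i = 0"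
proof -
  have lin: "complex_linear T" using assms(1) by (simp add: mat_alg_def)
  have row: "coord (T (basis_vec j)) i = 0" for j
    using assms by (auto simp: mat_alg_def matrix_entry_eq)
  have "(\<lambda>n. coord (T (coord_proj n x)) i) \<longlonglongrightarrow> coord (T x) i"
    by (intro bounded_linear.tendsto[OF bounded_linear_coord] blinfun.tendsto tendsto_const
        coord_proj_tendsto)
  moreover have "coord (T (coord_proj n x)) i = 0" for n
    by (simp add: complex_linear_coord_proj_expand[OF lin] coord_sum coord_simps row)
  ultimately show ?thesis by (simp add: LIMSEQ_const_iff)
qed

lemma mat_alg_zero: "0 \<in> mat_alg k"
proof (rule mat_algI)
  show "compact_operator 0" by (rule compact_operatorI[of "{0}"]) auto
qed (auto simp: complex_linear_def coord_simps)

lemma mat_alg_add: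
  assumes "S \<in> mat_alg k" "T \<in> mat_alg k" shows "S + T \<in> mat_alg k"
proof (rule mat_algI)
  show "complex_linear (S + T)"
    by (simp add: complex_linear_def blinfun.add_left assms[THEN mat_alg_linear] scaleC_add_right)
  show "compact_operator (S + T)" using assms[THEN mat_alg_compact] by (rule compact_operator_add)
  show "enat i < k \<and> enat j < k" if "coord ((S + T) (basis_vec j)) i \<noteq> 0" for i j
  proof -
    have "coord (S (basis_vec j)) i \<noteq> 0 \<or> coord (T (basis_vec j)) i \<noteq> 0"
      using that by (auto simp: blinfun.add_left coord_simps)
    then show ?thesis using assms unfolding mat_alg_def matrix_entry_eq by blast
  qed
qed

lemma op_scale_apply: "blinfun_apply (op_scale c T) x = scaleC c (T x)"
  unfolding op_scale_def
  by (subst bounded_linear_Blinfun_apply)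
     (auto intro: bounded_linear_compose[OF bounded_linear_scaleC_right] blinfun.bounded_linear_right)

lemma op_scale_diff: "op_scale c S - op_scale c T = op_scale c (S - T)"
  by (rule blinfun_eqI, rule ell2_eqI)
     (simp add: op_scale_apply blinfun.diff_left coord_simps algebra_simps)

lemma op_scale_of_real: "op_scale (complex_of_real r) T = r *\<^sub>R T"
  by (rule blinfun_eqI) (simp add: op_scale_apply scaleC_of_real blinfun.scaleR_left)

lemma norm_op_scale: "norm (op_scale c T) \<le> cmod c * norm T"
proof (rule norm_blinfun_bound)
  fix x show "norm (op_scale c T x) \<le> cmod c * norm T * norm x"
    using mult_left_mono[OF norm_blinfun[of T x], of "cmod c"]
    by (simp add: op_scale_apply norm_scaleC mult.assoc)
qed auto

lemma mat_alg_op_scale: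
  assumes "T \<in> mat_alg k" shows "op_scale c T \<in> mat_alg k"
proof (rule mat_algI)
  show "complex_linear (op_scale c T)"
    by (simp add: complex_linear_def op_scale_apply mat_alg_linear[OF assms] scaleC_scaleC
        mult.commute)
  have "op_scale c T = Blinfun (scaleC c) o\<^sub>L T"
    by (rule blinfun_eqI)
       (simp add: op_scale_apply bounded_linear_Blinfun_apply[OF bounded_linear_scaleC_right])
  then show "compact_operator (op_scale c T)"
    using mat_alg_compact[OF assms] by (simp add: compact_operator_compose_left)
  show "enat i < k \<and> enat j < k" if "coord (op_scale c T (basis_vec j)) i \<noteq> 0" for i j
    using that assms by (auto simp: op_scale_apply coord_simps mat_alg_def matrix_entry_eq)
qed

lemma mat_alg_scaleR: "T \<in> mat_alg k \<Longrightarrow> r *\<^sub>R T \<in> mat_alg k"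
  using mat_alg_op_scale[of T k "complex_of_real r"] by (simp add: op_scale_of_real)

lemma mat_alg_diff: "S \<in> mat_alg k \<Longrightarrow> T \<in> mat_alg k \<Longrightarrow> S - T \<in> mat_alg k"
  using mat_alg_add[of S k "(-1) *\<^sub>R T"] mat_alg_scaleR[of T k "-1"] by simp

lemma mat_alg_sum: "(\<And>a. a \<in> I \<Longrightarrow> f a \<in> mat_alg k) \<Longrightarrow> sum f I \<in> mat_alg k"
  by (induction I rule: infinite_finite_induct) (auto simp: mat_alg_zero mat_alg_add)

lemma mat_alg_compose:
  assumes "S \<in> mat_alg k" "T \<in> mat_alg k" shows "S o\<^sub>L T \<in> mat_alg k"
proof (rule mat_algI)
  show "complex_linear (S o\<^sub>L T)" using assms by (simp add: mat_alg_def complex_linear_compose)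
  show "compact_operator (S o\<^sub>L T)"
    using mat_alg_compact[OF assms(1)] by (rule compact_operator_compose_right)
  show "enat i < k \<and> enat j < k" if "coord ((S o\<^sub>L T) (basis_vec j)) i \<noteq> 0" for i j
    using that mat_alg_coord_zero[OF assms(1), of i] mat_alg_basis_zero[OF assms(2), of j]
    by (cases "enat j < k") (auto simp: coord_simps)
qed

lemma mat_alg_mono: "k \<le> l \<Longrightarrow> mat_alg k \<subseteq> mat_alg l"
  by (auto simp: mat_alg_def dest: order_less_le_trans)

lemma rank_one_basis_mat_alg:
  assumes "enat i < k" "\<And>j. \<not> enat j < k \<Longrightarrow> coord u j = 0"
  shows "rank_one u (basis_vec i) \<in> mat_alg k"
proof (rule mat_algI[OF complex_linear_rank_one compact_operator_rank_one])
  show "enat p < k \<and> enat q < k" if "coord (rank_one u (basis_vec i) (basis_vec q)) p \<noteq> 0" for p q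
    using that assms by (auto simp: rank_one.rep_eq coord_simps cinner_basis_right split: if_splits)
qed

lemma coord_proj_mat_alg: "enat n \<le> k \<Longrightarrow> coord_proj n \<in> mat_alg k"
  unfolding coord_proj_def
  by (rule mat_alg_sum, rule rank_one_basis_mat_alg)
     (auto simp: coord_simps intro: less_le_trans[of _ "enat n"] split: if_splits)

lemma coord_proj_absorb:
  assumes "T \<in> mat_alg (enat k)" shows "coord_proj k o\<^sub>L T = T"
  by (rule blinfun_eqI, rule ell2_eqI)
     (auto simp: coord_coord_proj mat_alg_coord_zero[OF assms])

text \<open>A compact operator nearly maps into a finite-dimensional coordinate subspace: the
  contractions \<open>1 - coord_proj n\<close> tend to zero pointwise, hence uniformly on a finite net of the
  precompact image of the unit ball.\<close>

lemma compact_operator_coord_proj_approx: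
  assumes "compact_operator T" "\<epsilon> > 0"
  shows "\<exists>n. norm ((coord_proj n o\<^sub>L T) - T) \<le> \<epsilon>"
proof -
  obtain C where C: "compact C" "\<And>x. norm x \<le> 1 \<Longrightarrow> blinfun_apply T x \<in> C"
    using compact_operatorD[OF assms(1)] by blast
  obtain F where F: "finite F" "C \<subseteq> (\<Union>y\<in>F. ball y (\<epsilon> / 2))"
    using compactE_image[OF C(1), of C "\<lambda>y. ball y (\<epsilon> / 2)"] assms(2)
    by (metis (no_types, lifting) UN_I centre_in_ball half_gt_zero open_ball subsetI)
  have "\<forall>y\<in>F. \<forall>\<^sub>F n in sequentially. norm (coord_proj n y - y) < \<epsilon> / 2"
    using tendstoD[OF coord_proj_tendsto, of "\<epsilon> / 2"] assms(2) by (auto simp: dist_norm)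
  then have "\<forall>\<^sub>F n in sequentially. \<forall>y\<in>F. norm (coord_proj n y - y) < \<epsilon> / 2"
    by (rule eventually_ball_finite[OF F(1)])
  then obtain n where n: "\<And>y. y \<in> F \<Longrightarrow> norm (coord_proj n y - y) < \<epsilon> / 2"
    using eventually_happens[of _ sequentially] by force
  have unit: "norm (coord_proj n (T x) - T x) \<le> \<epsilon>" if x: "norm x \<le> 1" for x
  proof -
    obtain y where y: "y \<in> F" "norm (T x - y) < \<epsilon> / 2"
      using C(2)[OF x] F(2) by (auto simp: dist_norm norm_minus_commute)
    have "coord_proj n (T x) - T x = (coord_proj n (T x - y) - (T x - y)) + (coord_proj n y - y)"
      by (simp add: blinfun.diff_right)
    then have "norm (coord_proj n (T x) - T x) \<le> norm (T x - y) + norm (coord_proj n y - y)"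
      using norm_triangle_ineq norm_coord_proj_compl_le[of n "T x - y"]
      by (smt (verit) add_right_mono)
    then show ?thesis using n[OF y(1)] y(2) by linarith
  qed
  have "norm ((coord_proj n o\<^sub>L T) - T) \<le> \<epsilon>"
  proof (rule norm_blinfun_bound)
    fix x :: ell2
    show "norm (((coord_proj n o\<^sub>L T) - T) x) \<le> \<epsilon> * norm x"
    proof (cases "x = 0")
      case False
      have "norm (((coord_proj n o\<^sub>L T) - T) ((1 / norm x) *\<^sub>R x)) \<le> \<epsilon>"
        using unit[of "(1 / norm x) *\<^sub>R x"] False by (simp add: blinfun.diff_left)
      then show ?thesis using False by (simp add: blinfun.scaleR_right divide_simps)
    qed simp
  qed (use assms(2) in simp)
  then show ?thesis ..
qed

text \<open>At a finite level the full unit matrix of that level leaves the operator unchanged; at level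
  \<open>\<infinity>\<close> compactness takes over.\<close>

lemma mat_alg_coord_proj_approx:
  assumes "T \<in> mat_alg k" "\<epsilon> > 0"
  shows "\<exists>n. enat n \<le> k \<and> norm ((coord_proj n o\<^sub>L T) - T) \<le> \<epsilon>"
proof (cases k)
  case (enat n)
  with assms show ?thesis by (intro exI[of _ n]) (simp add: coord_proj_absorb)
next
  case infinity
  with compact_operator_coord_proj_approx[OF mat_alg_compact[OF assms(1)] assms(2)]
  show ?thesis by simp
qed

section \<open>Slowly varying sequences and their cosets\<close>

lemma null_bounded_compose:
  fixes x y :: "nat \<Rightarrow> ell2 \<Rightarrow>\<^sub>L ell2"
  assumes "bounded (range x)" "y \<longlonglongrightarrow> 0"
  shows "(\<lambda>i. x i o\<^sub>L y i) \<longlonglongrightarrow> 0" "(\<lambda>i. y i o\<^sub>L x i) \<longlonglongrightarrow> 0"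
proof -
  obtain C where C: "\<And>i. norm (x i) \<le> C" using assms(1) by (auto simp: bounded_iff)
  have lim: "(\<lambda>i. C * norm (y i)) \<longlonglongrightarrow> 0"
    using tendsto_mult_right_zero[OF tendsto_norm_zero[OF assms(2)]] by simp
  show "(\<lambda>i. x i o\<^sub>L y i) \<longlonglongrightarrow> 0"
    by (rule Lim_null_comparison[OF always_eventually lim])
       (meson C norm_blinfun_compose mult_right_mono norm_ge_zero order_trans)
  show "(\<lambda>i. y i o\<^sub>L x i) \<longlonglongrightarrow> 0"
    by (rule Lim_null_comparison[OF always_eventually lim])
       (metis C norm_blinfun_compose mult.commute mult_right_mono norm_ge_zero order_trans)
qed

lemma slow_seq_simps:
  "add (slow_seq \<kappa>) x y = (\<lambda>i. x i + y i)"
  "mult (slow_seq \<kappa>) x y = (\<lambda>i. x i o\<^sub>L y i)"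
  "scale (slow_seq \<kappa>) c x = (\<lambda>i. op_scale c (x i))"
  "star (slow_seq \<kappa>) x = (\<lambda>i. op_adj (x i))"
  by (simp_all add: slow_seq_def)

lemma slow_carrier_iff:
  "m \<in> carrier (slow_seq \<kappa>) \<longleftrightarrow> m 0 = 0 \<and> (\<forall>i\<ge>1. m i \<in> mat_alg (\<kappa> i)) \<and> bounded (range m) \<and>
     (\<lambda>i. m (Suc i) - m i) \<longlonglongrightarrow> 0"
  by (simp add: slow_seq_def tendsto_norm_zero_iff)

lemma slow_carrierD:
  assumes "m \<in> carrier (slow_seq \<kappa>)"
  shows "m 0 = 0" "m i \<in> mat_alg (\<kappa> i)" "bounded (range m)" "(\<lambda>i. m (Suc i) - m i) \<longlonglongrightarrow> 0"
  using assms mat_alg_zero by (cases "i = 0"; auto simp: slow_carrier_iff)+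

lemma slow_carrierI:
  assumes "m 0 = 0" "\<And>i. i \<ge> 1 \<Longrightarrow> m i \<in> mat_alg (\<kappa> i)" "\<And>i. norm (m i) \<le> C"
    "(\<lambda>i. m (Suc i) - m i) \<longlonglongrightarrow> 0"
  shows "m \<in> carrier (slow_seq \<kappa>)"
  using assms by (auto simp: slow_carrier_iff bounded_iff)

lemma slow_bound:
  assumes "m \<in> carrier (slow_seq \<kappa>)" obtains C where "\<And>i. norm (m i) \<le> C"
  using slow_carrierD(3)[OF assms] by (auto simp: bounded_iff)

lemma slow_add:
  assumes "x \<in> carrier (slow_seq \<kappa>)" "y \<in> carrier (slow_seq \<kappa>)"
  shows "(\<lambda>i. x i + y i) \<in> carrier (slow_seq \<kappa>)"
proof -
  obtain C where C: "\<And>i. norm (x i) \<le> C" using slow_bound[OF assms(1)] by blast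
  obtain D where D: "\<And>i. norm (y i) \<le> D" using slow_bound[OF assms(2)] by blast
  show ?thesis
  proof (rule slow_carrierI)
    show "norm (x i + y i) \<le> C + D" for i by (rule norm_triangle_mono[OF C D])
    show "(\<lambda>i. x (Suc i) + y (Suc i) - (x i + y i)) \<longlonglongrightarrow> 0"
      using tendsto_add[OF assms[THEN slow_carrierD(4)]] by (simp add: algebra_simps)
  qed (simp_all add: assms[THEN slow_carrierD(1)] mat_alg_add assms[THEN slow_carrierD(2)])
qed

lemma slow_op_scale:
  assumes "x \<in> carrier (slow_seq \<kappa>)"
  shows "(\<lambda>i. op_scale c (x i)) \<in> carrier (slow_seq \<kappa>)"
proof -
  obtain C where C: "\<And>i. norm (x i) \<le> C" using slow_bound[OF assms] by blast
  show ?thesis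
  proof (rule slow_carrierI)
    show "op_scale c (x 0) = 0"
      by (rule blinfun_eqI) (simp add: slow_carrierD(1)[OF assms] op_scale_apply)
    show "norm (op_scale c (x i)) \<le> cmod c * C" for i
      using norm_op_scale[of c "x i"] mult_left_mono[OF C, of "cmod c" i] by simp
    have "(\<lambda>i. cmod c * norm (x (Suc i) - x i)) \<longlonglongrightarrow> 0"
      using tendsto_mult_right_zero[OF tendsto_norm_zero[OF slow_carrierD(4)[OF assms]]] by simp
    then show "(\<lambda>i. op_scale c (x (Suc i)) - op_scale c (x i)) \<longlonglongrightarrow> 0"
      unfolding op_scale_diff by (rule Lim_null_comparison[OF always_eventually, rotated]) (simp add: norm_op_scale)
  qed (simp add: mat_alg_op_scale slow_carrierD(2)[OF assms])
qed

lemma slow_diff: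
  assumes "x \<in> carrier (slow_seq \<kappa>)" "y \<in> carrier (slow_seq \<kappa>)"
  shows "(\<lambda>i. x i - y i) \<in> carrier (slow_seq \<kappa>)"
  using slow_add[OF assms(1) slow_op_scale[OF assms(2), of "complex_of_real (-1)"]]
  by (simp only: op_scale_of_real) simp

lemma slow_mult:
  assumes "x \<in> carrier (slow_seq \<kappa>)" "y \<in> carrier (slow_seq \<kappa>)"
  shows "(\<lambda>i. x i o\<^sub>L y i) \<in> carrier (slow_seq \<kappa>)"
proof -
  obtain C where C: "\<And>i. norm (x i) \<le> C" using slow_bound[OF assms(1)] by blast
  obtain D where D: "\<And>i. norm (y i) \<le> D" using slow_bound[OF assms(2)] by blast
  show ?thesis
  proof (rule slow_carrierI)
    show "norm (x i o\<^sub>L y i) \<le> C * D" for i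
      by (meson C D norm_blinfun_compose mult_mono norm_ge_zero order_trans)
    have "bounded (range (\<lambda>i. y (Suc i)))" using D by (auto simp: bounded_iff)
    then have "(\<lambda>i. ((x (Suc i) - x i) o\<^sub>L y (Suc i)) + (x i o\<^sub>L (y (Suc i) - y i))) \<longlonglongrightarrow> 0 + 0"
      using assms by (intro tendsto_add null_bounded_compose) (auto dest: slow_carrierD)
    moreover have "((x (Suc i) - x i) o\<^sub>L y (Suc i)) + (x i o\<^sub>L (y (Suc i) - y i))
        = (x (Suc i) o\<^sub>L y (Suc i)) - (x i o\<^sub>L y i)" for i
      by (rule blinfun_eqI) (simp add: blinfun.diff_left blinfun.add_left blinfun.diff_right)
    ultimately show "(\<lambda>i. (x (Suc i) o\<^sub>L y (Suc i)) - (x i o\<^sub>L y i)) \<longlonglongrightarrow> 0" by simp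
  qed (simp_all add: assms[THEN slow_carrierD(1)] mat_alg_compose assms[THEN slow_carrierD(2)])
qed

abbreviation slow_class :: "(nat \<Rightarrow> enat) \<Rightarrow> (nat \<Rightarrow> ell2 \<Rightarrow>\<^sub>L ell2) \<Rightarrow> (nat \<Rightarrow> ell2 \<Rightarrow>\<^sub>L ell2) set" where
  "slow_class \<kappa> \<equiv> ideal_coset (slow_seq \<kappa>) (null_ideal \<kappa>)"

text \<open>Membership in a coset is a statement about limits only; all computations in the quotient go
  through this description.\<close>

lemma slow_class_eq:
  assumes "x \<in> carrier (slow_seq \<kappa>)"
  shows "slow_class \<kappa> x = {y \<in> carrier (slow_seq \<kappa>). (\<lambda>i. y i - x i) \<longlonglongrightarrow> 0}"
proof (intro equalityI subsetI)
  fix y assume "y \<in> slow_class \<kappa> x"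
  then obtain z where z: "z \<in> carrier (slow_seq \<kappa>)" "z \<longlonglongrightarrow> 0" "y = (\<lambda>i. x i + z i)"
    by (auto simp: ideal_coset_def null_ideal_def tendsto_norm_zero_iff) (simp add: slow_seq_def)
  then show "y \<in> {y \<in> carrier (slow_seq \<kappa>). (\<lambda>i. y i - x i) \<longlonglongrightarrow> 0}"
    using slow_add[OF assms z(1)] by simp
next
  fix y assume "y \<in> {y \<in> carrier (slow_seq \<kappa>). (\<lambda>i. y i - x i) \<longlonglongrightarrow> 0}"
  then have y: "y \<in> carrier (slow_seq \<kappa>)" "(\<lambda>i. y i - x i) \<longlonglongrightarrow> 0" by auto
  then have "(\<lambda>i. y i - x i) \<in> null_ideal \<kappa>"
    by (simp add: null_ideal_def slow_diff assms tendsto_norm_zero_iff)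
  moreover have "y = add (slow_seq \<kappa>) x (\<lambda>i. y i - x i)" by (simp add: slow_seq_def)
  ultimately show "y \<in> slow_class \<kappa> x" unfolding ideal_coset_def by blast
qed

lemma null_diff_sym: "(\<lambda>i. x i - y i) \<longlonglongrightarrow> (0::'a::real_normed_vector) \<Longrightarrow> (\<lambda>i. y i - x i) \<longlonglongrightarrow> 0"
  using tendsto_minus[of "\<lambda>i. x i - y i" 0] by simp

lemma null_diff_trans:
  "(\<lambda>i. x i - y i) \<longlonglongrightarrow> (0::'a::real_normed_vector) \<Longrightarrow> (\<lambda>i. y i - z i) \<longlonglongrightarrow> 0
    \<Longrightarrow> (\<lambda>i. x i - z i) \<longlonglongrightarrow> 0"
  using tendsto_add[of "\<lambda>i. x i - y i" 0 _ "\<lambda>i. y i - z i" 0] by simp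

lemma slow_class_eq_iff:
  assumes "x \<in> carrier (slow_seq \<kappa>)" "y \<in> carrier (slow_seq \<kappa>)"
  shows "slow_class \<kappa> x = slow_class \<kappa> y \<longleftrightarrow> (\<lambda>i. x i - y i) \<longlonglongrightarrow> 0"
proof
  assume "slow_class \<kappa> x = slow_class \<kappa> y"
  moreover have "x \<in> slow_class \<kappa> x" using assms by (simp add: slow_class_eq)
  ultimately show "(\<lambda>i. x i - y i) \<longlonglongrightarrow> 0" using assms by (simp add: slow_class_eq)
next
  assume "(\<lambda>i. x i - y i) \<longlonglongrightarrow> 0"
  with assms show "slow_class \<kappa> x = slow_class \<kappa> y"
    by (auto simp: slow_class_eq intro: null_diff_trans null_diff_sym)
qed

lemma slow_class_self: "x \<in> carrier (slow_seq \<kappa>) \<Longrightarrow> x \<in> slow_class \<kappa> x"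
  by (simp add: slow_class_eq)

lemma slow_quot_carrier: "carrier (slow_quot \<kappa>) = slow_class \<kappa> ` carrier (slow_seq \<kappa>)"
  by (simp add: slow_quot_def quotient_algebra_def)

lemma UN_const_eq: "a \<in> X \<Longrightarrow> (\<And>x. x \<in> X \<Longrightarrow> f x = c) \<Longrightarrow> (\<Union>x\<in>X. f x) = c"
  by auto

lemma slow_quot_add:
  assumes "x \<in> carrier (slow_seq \<kappa>)" "y \<in> carrier (slow_seq \<kappa>)"
  shows "add (slow_quot \<kappa>) (slow_class \<kappa> x) (slow_class \<kappa> y) = slow_class \<kappa> (\<lambda>i. x i + y i)"
proof -
  have "slow_class \<kappa> (\<lambda>i. x' i + y' i) = slow_class \<kappa> (\<lambda>i. x i + y i)"
    if "x' \<in> slow_class \<kappa> x" "y' \<in> slow_class \<kappa> y" for x' y'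
  proof -
    have "(\<lambda>i. (x' i - x i) + (y' i - y i)) \<longlonglongrightarrow> 0 + 0"
      using that assms by (intro tendsto_add) (auto simp: slow_class_eq)
    then show ?thesis
      using that assms by (subst slow_class_eq_iff) (auto simp: slow_class_eq slow_add algebra_simps)
  qed
  then have "(\<Union>x'\<in>slow_class \<kappa> x. \<Union>y'\<in>slow_class \<kappa> y. slow_class \<kappa> (\<lambda>i. x' i + y' i)) = slow_class \<kappa> (\<lambda>i. x i + y i)"
    by (intro UN_const_eq[OF slow_class_self[OF assms(1)]] UN_const_eq[OF slow_class_self[OF assms(2)]])
  then show ?thesis by (simp add: slow_quot_def quotient_algebra_def slow_seq_simps)
qed

lemma slow_quot_mult:
  assumes "x \<in> carrier (slow_seq \<kappa>)" "y \<in> carrier (slow_seq \<kappa>)"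
  shows "mult (slow_quot \<kappa>) (slow_class \<kappa> x) (slow_class \<kappa> y) = slow_class \<kappa> (\<lambda>i. x i o\<^sub>L y i)"
proof -
  have "slow_class \<kappa> (\<lambda>i. x' i o\<^sub>L y' i) = slow_class \<kappa> (\<lambda>i. x i o\<^sub>L y i)"
    if "x' \<in> slow_class \<kappa> x" "y' \<in> slow_class \<kappa> y" for x' y'
  proof -
    have "(\<lambda>i. ((x' i - x i) o\<^sub>L y' i) + (x i o\<^sub>L (y' i - y i))) \<longlonglongrightarrow> 0 + 0"
      using that assms
      by (intro tendsto_add null_bounded_compose) (auto simp: slow_class_eq dest: slow_carrierD)
    moreover have "((x' i - x i) o\<^sub>L y' i) + (x i o\<^sub>L (y' i - y i)) = (x' i o\<^sub>L y' i) - (x i o\<^sub>L y i)" for i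
      by (rule blinfun_eqI) (simp add: blinfun.diff_left blinfun.add_left blinfun.diff_right)
    ultimately show ?thesis
      using that assms by (subst slow_class_eq_iff) (auto simp: slow_class_eq slow_mult)
  qed
  then have "(\<Union>x'\<in>slow_class \<kappa> x. \<Union>y'\<in>slow_class \<kappa> y. slow_class \<kappa> (\<lambda>i. x' i o\<^sub>L y' i)) = slow_class \<kappa> (\<lambda>i. x i o\<^sub>L y i)"
    by (intro UN_const_eq[OF slow_class_self[OF assms(1)]] UN_const_eq[OF slow_class_self[OF assms(2)]])
  then show ?thesis by (simp add: slow_quot_def quotient_algebra_def slow_seq_simps)
qed

lemma slow_quot_scale:
  assumes "x \<in> carrier (slow_seq \<kappa>)"
  shows "scale (slow_quot \<kappa>) c (slow_class \<kappa> x) = slow_class \<kappa> (\<lambda>i. op_scale c (x i))"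
proof -
  have "slow_class \<kappa> (\<lambda>i. op_scale c (x' i)) = slow_class \<kappa> (\<lambda>i. op_scale c (x i))"
    if "x' \<in> slow_class \<kappa> x" for x'
  proof -
    have "(\<lambda>i. cmod c * norm (x' i - x i)) \<longlonglongrightarrow> 0"
      using that assms tendsto_mult_right_zero[OF tendsto_norm_zero]
      by (auto simp: slow_class_eq)
    then have "(\<lambda>i. op_scale c (x' i) - op_scale c (x i)) \<longlonglongrightarrow> 0"
      unfolding op_scale_diff by (rule Lim_null_comparison[OF always_eventually, rotated]) (simp add: norm_op_scale)
    then show ?thesis
      using that assms by (subst slow_class_eq_iff) (auto simp: slow_class_eq slow_op_scale)
  qed
  then have "(\<Union>x'\<in>slow_class \<kappa> x. slow_class \<kappa> (\<lambda>i. op_scale c (x' i))) = slow_class \<kappa> (\<lambda>i. op_scale c (x i))"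
    by (rule UN_const_eq[OF slow_class_self[OF assms]])
  then show ?thesis by (simp add: slow_quot_def quotient_algebra_def slow_seq_simps)
qed

lemma slow_zero: "(\<lambda>i. 0) \<in> carrier (slow_seq \<kappa>)"
  by (rule slow_carrierI[where C = 0]) (auto simp: mat_alg_zero)

lemma slow_quot_zero: "zero (slow_quot \<kappa>) = slow_class \<kappa> (\<lambda>i. 0)"
  by (simp add: slow_class_eq[OF slow_zero] slow_quot_def quotient_algebra_def)
     (simp add: null_ideal_def tendsto_norm_zero_iff)

section \<open>Slowly varying approximate units\<close>

text \<open>The unit matrices \<open>coord_proj (n i)\<close> jump by norm one whenever \<open>n\<close> changes.  Relaxing towards
  them at rate \<open>t i\<close> gives increments of norm at most \<open>2 t i\<close>.  For \<open>t i = 1 / (i + 1)\<close> the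
  result is the arithmetic mean of the first \<open>i\<close> unit matrices.\<close>

primrec ramp :: "(nat \<Rightarrow> real) \<Rightarrow> (nat \<Rightarrow> nat) \<Rightarrow> nat \<Rightarrow> ell2 \<Rightarrow>\<^sub>L ell2" where
  "ramp t n 0 = 0"
| "ramp t n (Suc i) = (1 - t i) *\<^sub>R ramp t n i + t i *\<^sub>R coord_proj (n (Suc i))"

lemma norm_ramp_le:
  assumes "\<And>i. 0 \<le> t i" "\<And>i. t i \<le> 1"
  shows "norm (ramp t n i) \<le> 1"
proof (induction i)
  case (Suc i)
  have "norm (ramp t n (Suc i)) \<le> (1 - t i) * norm (ramp t n i) + t i * norm (coord_proj (n (Suc i)))"
    using norm_triangle_ineq[of "(1 - t i) *\<^sub>R ramp t n i" "t i *\<^sub>R coord_proj (n (Suc i))"] assms[of i]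
    by simp
  also have "\<dots> \<le> (1 - t i) * 1 + t i * 1"
    using Suc assms[of i] norm_coord_proj_le by (intro add_mono mult_left_mono) auto
  finally show ?case by simp
qed simp

lemma ramp_slow:
  assumes t: "\<And>i. 0 \<le> t i" "\<And>i. t i \<le> 1" "t \<longlonglongrightarrow> 0"
    and mono: "mono_on {1..} \<kappa>" and n: "\<And>i. i \<ge> 1 \<Longrightarrow> enat (n i) \<le> \<kappa> i"
  shows "ramp t n \<in> carrier (slow_seq \<kappa>)"
proof (rule slow_carrierI[where C = 1])
  have mem: "ramp t n (Suc i) \<in> mat_alg (\<kappa> (Suc i))" for i
  proof (induction i)
    case 0
    show ?case using n[of 1] by (simp add: mat_alg_scaleR coord_proj_mat_alg)
  next
    case (Suc i)
    have "\<kappa> (Suc i) \<le> \<kappa> (Suc (Suc i))" by (rule mono_onD[OF mono]) auto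
    then have "ramp t n (Suc i) \<in> mat_alg (\<kappa> (Suc (Suc i)))"
      using mat_alg_mono Suc by blast
    then show ?case
      unfolding ramp.simps(2)[of t n "Suc i"]
      by (intro mat_alg_add mat_alg_scaleR coord_proj_mat_alg n) auto
  qed
  then show "ramp t n i \<in> mat_alg (\<kappa> i)" if "i \<ge> 1" for i
    using that by (cases i) auto
  have "ramp t n (Suc i) - ramp t n i = t i *\<^sub>R (coord_proj (n (Suc i)) - ramp t n i)" for i
    by (simp add: algebra_simps)
  moreover have "norm (coord_proj k - ramp t n i) \<le> 2" for k i
    using norm_triangle_ineq4[of "coord_proj k" "ramp t n i"] norm_coord_proj_le[of k]
      norm_ramp_le[of t n i] t by force
  ultimately have "norm (ramp t n (Suc i) - ramp t n i) \<le> t i * 2" for i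
    using t(1)[of i] by (simp add: mult_left_mono del: ramp.simps)
  then show "(\<lambda>i. ramp t n (Suc i) - ramp t n i) \<longlonglongrightarrow> 0"
    by (intro Lim_null_comparison[OF always_eventually tendsto_mult_left_zero[OF t(3), of 2]]) blast
qed (use norm_ramp_le t in auto)

text \<open>A weighted relaxation inequality.  Since \<open>t i \<ge> 1 / (i + 1)\<close>, the excess of \<open>d i\<close> over
  any \<open>\<epsilon>\<close> that eventually bounds \<open>\<eta>\<close> is at most a multiple of \<open>1 / i\<close>.\<close>

lemma relaxation_tendsto_0:
  fixes d t \<eta> :: "nat \<Rightarrow> real"
  assumes "\<And>i. 0 \<le> d i" "\<And>i. 1 / (real i + 1) \<le> t i" "\<And>i. t i \<le> 1" "\<eta> \<longlonglongrightarrow> 0"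
    and step: "\<And>i. d (Suc i) \<le> (1 - t i) * d i + t i * \<eta> i"
  shows "d \<longlonglongrightarrow> 0"
proof (rule LIMSEQ_I)
  fix r :: real assume r: "r > 0"
  define \<epsilon> where "\<epsilon> = r / 2"
  have \<epsilon>: "\<epsilon> > 0" using r by (simp add: \<epsilon>_def)
  obtain N where N: "\<And>i. i \<ge> N \<Longrightarrow> \<eta> i < \<epsilon>"
    using order_tendstoD(2)[OF assms(4) \<epsilon>] by (auto simp: eventually_sequentially)
  define p where "p i = max 0 (d i - \<epsilon>)" for i
  have p_step: "real (Suc i) * p (Suc i) \<le> real i * p i" if "i \<ge> N" for i
  proof -
    have "t i * \<eta> i \<le> t i * \<epsilon>"
      using N[OF that] assms(2)[of i] by (intro mult_left_mono) (auto intro: order_trans[rotated])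
    with step[of i] have "d (Suc i) - \<epsilon> \<le> (1 - t i) * (d i - \<epsilon>)" by (simp add: algebra_simps)
    also have "\<dots> \<le> (1 - t i) * p i" using assms(3)[of i] by (intro mult_left_mono) (auto simp: p_def)
    also have "\<dots> \<le> (1 - 1 / (real i + 1)) * p i"
      using assms(2)[of i] by (intro mult_right_mono) (auto simp: p_def)
    finally have "d (Suc i) - \<epsilon> \<le> (1 - 1 / (real i + 1)) * p i" .
    moreover have "0 \<le> (1 - 1 / (real i + 1)) * p i" by (intro mult_nonneg_nonneg) (auto simp: p_def)
    ultimately have "p (Suc i) \<le> (1 - 1 / (real i + 1)) * p i" by (simp add: p_def)
    then have "real (Suc i) * p (Suc i) \<le> real (Suc i) * ((1 - 1 / (real i + 1)) * p i)"
      by (intro mult_left_mono) auto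
    also have "\<dots> = real i * p i" by (simp add: field_simps)
    finally show ?thesis .
  qed
  have bound: "real i * p i \<le> real N * p N" if "i \<ge> N" for i
    using that by (induction i rule: dec_induct) (use p_step in \<open>auto intro: order_trans\<close>)
  have "(\<lambda>i. real N * p N * inverse (real i)) \<longlonglongrightarrow> 0"
    by (intro tendsto_mult_right_zero lim_inverse_n)
  from order_tendstoD(2)[OF this \<epsilon>]
  obtain M where M: "\<And>i. i \<ge> M \<Longrightarrow> real N * p N * inverse (real i) < \<epsilon>"
    by (auto simp: eventually_sequentially)
  have "norm (d i - 0) < r" if "i \<ge> Suc (max N M)" for i
  proof -
    have "p i \<le> real N * p N * inverse (real i)"
      using bound[of i] that by (simp add: field_simps)
    also have "\<dots> < \<epsilon>" using M[of i] that by simp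
    finally have "p i < \<epsilon>" .
    then have "d i < r" unfolding p_def \<epsilon>_def by linarith
    with assms(1)[of i] show ?thesis by simp
  qed
  then show "\<exists>no. \<forall>i\<ge>no. norm (d i - 0) < r" by blast
qed

text \<open>Every slow sequence is, up to a null sequence, a product of two slow sequences.  The left
  factor relaxes towards the current cut-off \<open>coord_proj (n i)\<close> at a rate \<open>t i\<close> that is
  itself null, which makes it slow, but dominates both the increments of \<open>x\<close> and the harmonic
  rate, which lets it catch up.\<close>

lemma slow_approx_unit:
  assumes x: "x \<in> carrier (slow_seq \<kappa>)" and mono: "mono_on {1..} \<kappa>"
  obtains e where "e \<in> carrier (slow_seq \<kappa>)" "(\<lambda>i. (e i o\<^sub>L x i) - x i) \<longlonglongrightarrow> 0"
proof -
  have "\<exists>n. enat n \<le> \<kappa> i \<and> norm ((coord_proj n o\<^sub>L x i) - x i) \<le> 1 / real i" if "i \<ge> 1" for i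
    by (rule mat_alg_coord_proj_approx[OF slow_carrierD(2)[OF x]]) (use that in simp)
  then obtain n where n: "\<And>i. i \<ge> 1 \<Longrightarrow> enat (n i) \<le> \<kappa> i"
      "\<And>i. i \<ge> 1 \<Longrightarrow> norm ((coord_proj (n i) o\<^sub>L x i) - x i) \<le> 1 / real i"
    by metis
  define \<epsilon> where "\<epsilon> i = norm (x (Suc i) - x i)" for i
  have \<epsilon>: "\<epsilon> \<longlonglongrightarrow> 0" unfolding \<epsilon>_def by (rule tendsto_norm_zero[OF slow_carrierD(4)[OF x]])
  have \<epsilon>0: "\<epsilon> i \<ge> 0" for i by (simp add: \<epsilon>_def)
  define t where "t i = min 1 (max (1 / (real i + 1)) (sqrt (\<epsilon> i)))" for i
  define \<eta> where "\<eta> i = 2 * (\<epsilon> i + sqrt (\<epsilon> i)) + 1 / (real i + 1)" for i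
  have t_ge: "1 / (real i + 1) \<le> t i" and t_le: "t i \<le> 1" for i
    by (auto simp: t_def)
  have t0: "0 \<le> t i" for i by (rule order_trans[OF _ t_ge]) simp
  have harm: "(\<lambda>i. 1 / (real i + 1)) \<longlonglongrightarrow> 0"
    using LIMSEQ_inverse_real_of_nat by (simp add: inverse_eq_divide add.commute)
  have sq: "(\<lambda>i. sqrt (\<epsilon> i)) \<longlonglongrightarrow> 0" using tendsto_real_sqrt[OF \<epsilon>] by simp
  have "t \<longlonglongrightarrow> min 1 (max 0 0)" unfolding t_def by (intro tendsto_min tendsto_max tendsto_const harm sq)
  then have t_lim: "t \<longlonglongrightarrow> 0" by simp
  have \<eta>_lim: "\<eta> \<longlonglongrightarrow> 0"
    unfolding \<eta>_def using tendsto_add[OF tendsto_mult_right_zero[OF tendsto_add_zero[OF \<epsilon> sq], of 2] harm] by simp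
  \<comment> \<open>Either the square root of the increment is below the rate, or the rate is capped at one.\<close>
  have rate: "\<epsilon> i \<le> t i * (\<epsilon> i + sqrt (\<epsilon> i))" for i
  proof (cases "t i = 1")
    case False
    then have "sqrt (\<epsilon> i) \<le> t i" by (auto simp: t_def min_def split: if_splits)
    then have "sqrt (\<epsilon> i) * sqrt (\<epsilon> i) \<le> t i * (\<epsilon> i + sqrt (\<epsilon> i))"
      using \<epsilon>0[of i] t0[of i] by (intro mult_mono) auto
    then show ?thesis using \<epsilon>0[of i] by simp
  qed (use \<epsilon>0 in simp)
  define e where "e = ramp t n"
  define d where "d i = norm ((e i o\<^sub>L x i) - x i)" for i
  have "d \<longlonglongrightarrow> 0"
  proof (rule relaxation_tendsto_0[OF _ t_ge t_le \<eta>_lim])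
    fix i
    show "0 \<le> d i" by (simp add: d_def)
    let ?y = "x (Suc i) - x i"
    \<comment> \<open>The old factor still absorbs the new entry up to the increment of the sequence.\<close>
    have "(e i o\<^sub>L x (Suc i)) - x (Suc i) = ((e i o\<^sub>L x i) - x i) + ((e i o\<^sub>L ?y) - ?y)"
      by (rule blinfun_eqI) (simp add: blinfun.diff_left blinfun.add_left blinfun.diff_right)
    then have "norm ((e i o\<^sub>L x (Suc i)) - x (Suc i)) \<le> d i + norm ((e i o\<^sub>L ?y) - ?y)"
      by (metis d_def norm_triangle_ineq)
    also have "norm ((e i o\<^sub>L ?y) - ?y) \<le> norm (e i) * \<epsilon> i + \<epsilon> i"
      unfolding \<epsilon>_def by (meson norm_triangle_ineq4 norm_blinfun_compose add_right_mono order_trans)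
    also have "norm (e i) * \<epsilon> i \<le> \<epsilon> i"
      using norm_ramp_le[of t n i] t0 t_le \<epsilon>0[of i] by (simp add: e_def mult_left_le_one_le)
    finally have old: "norm ((e i o\<^sub>L x (Suc i)) - x (Suc i)) \<le> d i + 2 * \<epsilon> i" by simp
    have "(e (Suc i) o\<^sub>L x (Suc i)) - x (Suc i) =
        (1 - t i) *\<^sub>R ((e i o\<^sub>L x (Suc i)) - x (Suc i)) +
        t i *\<^sub>R ((coord_proj (n (Suc i)) o\<^sub>L x (Suc i)) - x (Suc i))"
      by (rule blinfun_eqI)
         (simp add: e_def blinfun.diff_left blinfun.add_left blinfun.scaleR_left algebra_simps)
    then have "d (Suc i) \<le> (1 - t i) * norm ((e i o\<^sub>L x (Suc i)) - x (Suc i)) +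
        t i * norm ((coord_proj (n (Suc i)) o\<^sub>L x (Suc i)) - x (Suc i))"
      unfolding d_def using t0[of i] t_le[of i]
      by (metis abs_of_nonneg diff_ge_0_iff_ge norm_scaleR norm_triangle_ineq)
    also have "\<dots> \<le> (1 - t i) * (d i + 2 * \<epsilon> i) + t i * (1 / (real i + 1))"
      using old n(2)[of "Suc i"] t0[of i] t_le[of i]
      by (intro add_mono mult_left_mono) (auto simp: add.commute)
    also have "\<dots> \<le> (1 - t i) * d i + 2 * \<epsilon> i + t i * (1 / (real i + 1))"
      using t0[of i] \<epsilon>0[of i] by (simp add: algebra_simps)
    also have "\<dots> \<le> (1 - t i) * d i + t i * \<eta> i"
      using rate[of i] by (simp add: \<eta>_def algebra_simps)
    finally show "d (Suc i) \<le> (1 - t i) * d i + t i * \<eta> i" .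
  qed
  then have "(\<lambda>i. (e i o\<^sub>L x i) - x i) \<longlonglongrightarrow> 0" unfolding d_def by (simp add: tendsto_norm_zero_iff)
  moreover have "e \<in> carrier (slow_seq \<kappa>)"
    unfolding e_def by (rule ramp_slow[OF t0 t_le t_lim mono n(1)])
  ultimately show ?thesis using that by blast
qed

section \<open>Two isometries with complementary ranges\<close>

lemma two_div_two_odd: "p = 2 * (p div 2) + of_bool (odd p)" for p :: nat
  by (cases "odd p") auto

lemma sums_interleave:
  fixes f :: "nat \<Rightarrow> real"
  shows "f sums c \<Longrightarrow> (\<lambda>p. if odd p = b then f (p div 2) else 0) sums c"
proof -
  assume "f sums c"
  moreover have "strict_mono (\<lambda>j::nat. 2 * j + of_bool b)" by (rule strict_monoI) simp
  moreover have "(if odd p = b then f (p div 2) else 0) = 0"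
    if "p \<notin> range (\<lambda>j. 2 * j + of_bool b)" for p
  proof -
    have "p = 2 * (p div 2) + of_bool (odd p)" by (rule two_div_two_odd)
    then have "odd p \<noteq> b" using that by blast
    then show ?thesis by simp
  qed
  moreover have "(\<lambda>j. if odd (2 * j + of_bool b) = b then f ((2 * j + of_bool b) div 2) else 0) = f"
    by (cases b) (auto simp: fun_eq_iff)
  ultimately show ?thesis
    using sums_mono_reindex[of "\<lambda>j. 2 * j + of_bool b"
        "\<lambda>p. if odd p = b then f (p div 2) else 0" c] by simp
qed

lift_definition interleave_vec :: "bool \<Rightarrow> ell2 \<Rightarrow> ell2" is
  "\<lambda>b x p. if odd p = b then x (p div 2) else 0"
proof -
  fix b :: bool and x :: "nat \<Rightarrow> complex"
  assume "summable (\<lambda>n. (cmod (x n))\<^sup>2)"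
  then have "summable (\<lambda>p. if odd p = b then (cmod (x (p div 2)))\<^sup>2 else 0)"
    using sums_interleave[of "\<lambda>n. (cmod (x n))\<^sup>2" _ b] unfolding summable_def by blast
  then show "summable (\<lambda>p. (cmod (if odd p = b then x (p div 2) else 0))\<^sup>2)"
    by (rule back_subst[of summable]) auto
qed

lemma norm_interleave_vec: "norm (interleave_vec b x) = norm x"
proof -
  have "(\<lambda>p. if odd p = b then (cmod (coord x (p div 2)))\<^sup>2 else 0) sums (norm x)\<^sup>2"
    unfolding norm_ell2_sq by (rule sums_interleave[OF summable_sums[OF coord_summable_sq]])
  moreover have "(\<lambda>p. if odd p = b then (cmod (coord x (p div 2)))\<^sup>2 else 0) =
      (\<lambda>p. (cmod (coord (interleave_vec b x) p))\<^sup>2)"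
    by (auto simp: interleave_vec.rep_eq)
  ultimately have "(norm (interleave_vec b x))\<^sup>2 = (norm x)\<^sup>2"
    by (simp add: norm_ell2_sq sums_iff)
  then show ?thesis by simp
qed

text \<open>The two isometries \<open>e\<^sub>j \<mapsto> e\<^sub>2\<^sub>j\<close> (for \<open>False\<close>) and \<open>e\<^sub>j \<mapsto> e\<^sub>2\<^sub>j\<^sub>+\<^sub>1\<close> (for \<open>True\<close>) and, below,
  their adjoints.  They generate a Cuntz algebra: each adjoint is a left inverse, and the two range
  projections add up to the identity.\<close>

lift_definition interleave :: "bool \<Rightarrow> (ell2 \<Rightarrow>\<^sub>L ell2)" is interleave_vec
  by (rule bounded_linear_intro[where K = 1])
     (auto intro!: ell2_eqI simp: norm_interleave_vec interleave_vec.rep_eq coord_simps)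

lift_definition deinterleave_vec :: "bool \<Rightarrow> ell2 \<Rightarrow> ell2" is "\<lambda>b x j. x (2 * j + of_bool b)"
proof -
  fix b :: bool and x :: "nat \<Rightarrow> complex"
  assume "summable (\<lambda>n. (cmod (x n))\<^sup>2)"
  then have "summable ((\<lambda>n. (cmod (x n))\<^sup>2) \<circ> (\<lambda>j. 2 * j + of_bool b))"
    by (rule summable_reindex) (auto intro: injI)
  then show "summable (\<lambda>j. (cmod (x (2 * j + of_bool b)))\<^sup>2)" by (simp add: o_def)
qed

lemma norm_deinterleave_vec_le: "norm (deinterleave_vec b x) \<le> norm x"
  unfolding norm_interleave_vec[of b "deinterleave_vec b x", symmetric]
proof (rule norm_ell2_mono)
  fix p :: nat
  have "p = 2 * (p div 2) + of_bool (odd p)" by (rule two_div_two_odd)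
  then show "cmod (coord (interleave_vec b (deinterleave_vec b x)) p) \<le> cmod (coord x p)"
    by (auto simp: interleave_vec.rep_eq deinterleave_vec.rep_eq)
qed

lift_definition deinterleave :: "bool \<Rightarrow> (ell2 \<Rightarrow>\<^sub>L ell2)" is deinterleave_vec
  by (rule bounded_linear_intro[where K = 1])
     (auto intro!: ell2_eqI simp: norm_deinterleave_vec_le deinterleave_vec.rep_eq coord_simps)

lemma coord_interleave: "coord (interleave b x) p = (if odd p = b then coord x (p div 2) else 0)"
  by (simp add: interleave.rep_eq interleave_vec.rep_eq)

lemma coord_deinterleave: "coord (deinterleave b x) j = coord x (2 * j + of_bool b)"
  by (simp add: deinterleave.rep_eq deinterleave_vec.rep_eq)

lemma deinterleave_interleave: "deinterleave b (interleave b x) = x"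
  by (rule ell2_eqI, cases b) (auto simp: coord_deinterleave coord_interleave)

lemma interleave_deinterleave:
  "interleave False (deinterleave False x) + interleave True (deinterleave True x) = x"
proof (rule ell2_eqI)
  fix p :: nat
  have "p = 2 * (p div 2) + of_bool (odd p)" by (rule two_div_two_odd)
  then show "coord (interleave False (deinterleave False x) + interleave True (deinterleave True x)) p
      = coord x p"
    by (cases "odd p") (auto simp: coord_simps coord_deinterleave coord_interleave)
qed

lemma norm_interleave: "norm (interleave b x) = norm x"
  by (simp add: interleave.rep_eq norm_interleave_vec)

lemma norm_interleave_add:
  "(norm (interleave False x + interleave True y))\<^sup>2 = (norm x)\<^sup>2 + (norm y)\<^sup>2"
proof -
  have "inner (interleave False x) (interleave True y) = 0"
    unfolding inner_ell2_def cinner_def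
    by (subst suminf_cong[where g = "\<lambda>_. 0"]) (auto simp: coord_interleave)
  then have "(norm (interleave False x + interleave True y))\<^sup>2 =
      (norm (interleave False x))\<^sup>2 + (norm (interleave True y))\<^sup>2"
    by (simp add: power2_norm_eq_inner inner_add_left inner_add_right inner_commute)
  then show ?thesis by (simp add: norm_interleave)
qed

definition conj_interleave :: "bool \<Rightarrow> (ell2 \<Rightarrow>\<^sub>L ell2) \<Rightarrow> (ell2 \<Rightarrow>\<^sub>L ell2)" where
  "conj_interleave b T = interleave b o\<^sub>L T o\<^sub>L deinterleave b"

definition double :: "(ell2 \<Rightarrow>\<^sub>L ell2) \<Rightarrow> (ell2 \<Rightarrow>\<^sub>L ell2)" where
  "double T = conj_interleave False T + conj_interleave True T"

text \<open>The two copies act on orthogonal subspaces, so the norm of their sum does not double.  This is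
  what makes the amplification equation solvable.\<close>

lemma norm_double_le: "norm (double T) \<le> norm T"
proof (rule norm_blinfun_bound)
  fix x
  let ?u = "deinterleave False x" and ?v = "deinterleave True x"
  have "(norm (double T x))\<^sup>2 = (norm (T ?u))\<^sup>2 + (norm (T ?v))\<^sup>2"
    by (simp add: double_def conj_interleave_def blinfun.add_left norm_interleave_add)
  also have "\<dots> \<le> (norm T * norm ?u)\<^sup>2 + (norm T * norm ?v)\<^sup>2"
    by (intro add_mono power_mono norm_blinfun) auto
  also have "\<dots> = (norm T)\<^sup>2 * (norm (interleave False ?u + interleave True ?v))\<^sup>2"
    by (simp add: norm_interleave_add power_mult_distrib distrib_left)
  also have "\<dots> = (norm T * norm x)\<^sup>2"
    by (simp add: interleave_deinterleave power_mult_distrib)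
  finally show "norm (double T x) \<le> norm T * norm x"
    by (rule power2_le_imp_le) simp
qed simp

lemma blinfun_compose_assoc: "(R o\<^sub>L S) o\<^sub>L T = R o\<^sub>L (S o\<^sub>L T)"
  by (rule blinfun_eqI) simp

lemma bounded_linear_compose_left: "bounded_linear (\<lambda>T. S o\<^sub>L T)"
  by (rule bounded_bilinear.bounded_linear_right[OF bounded_bilinear_blinfun_compose])

lemma bounded_linear_compose_right: "bounded_linear (\<lambda>T. T o\<^sub>L S)"
  by (rule bounded_bilinear.bounded_linear_left[OF bounded_bilinear_blinfun_compose])

lemma double_diff: "double (S - T) = double S - double T"
  by (rule blinfun_eqI)
     (simp add: double_def conj_interleave_def blinfun.add_left blinfun.diff_left blinfun.diff_right)

text \<open>The levels may be infinite, and then doubling does not enlarge them.\<close>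

lemma enat_less_double:
  assumes "enat (p div 2) < k" "k + k \<le> l" shows "enat p < l"
proof (cases k)
  case (enat n)
  with assms(1) have "enat p < k + k" by simp
  with assms(2) show ?thesis by simp
next
  case infinity
  with assms(2) show ?thesis by simp
qed

lemma enat_less_of_double:
  assumes "enat p < k" "k + k \<le> l" shows "enat p < l"
  using enat_less_double[of p k l] assms le_less_trans[of "enat (p div 2)" "enat p" k] by simp

lemma complex_linear_interleave: "complex_linear (interleave b)"
  unfolding complex_linear_def by (auto intro!: ell2_eqI simp: coord_interleave coord_simps)

lemma complex_linear_deinterleave: "complex_linear (deinterleave b)"
  unfolding complex_linear_def by (auto intro!: ell2_eqI simp: coord_deinterleave coord_simps)

lemma deinterleave_basis:
  "deinterleave b (basis_vec q) = (if odd q = b then basis_vec (q div 2) else 0)"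
proof (rule ell2_eqI)
  fix n :: nat
  have "2 * n + of_bool b = q \<longleftrightarrow> odd q = b \<and> n = q div 2" by (cases b) auto
  then show "coord (deinterleave b (basis_vec q)) n
      = coord (if odd q = b then basis_vec (q div 2) else 0) n"
    by (auto simp: coord_deinterleave coord_simps)
qed

lemma interleave_mat_alg:
  assumes T: "T \<in> mat_alg k" and kl: "k + k \<le> l"
  shows "interleave b o\<^sub>L T \<in> mat_alg l" (is ?left)
    and "T o\<^sub>L deinterleave b \<in> mat_alg l" (is ?right)
    and "conj_interleave b T \<in> mat_alg l" (is ?conj)
proof -
  have lin: "complex_linear T" and cpt: "compact_operator T" using T by (auto simp: mat_alg_def)
  have entry: "enat p < k \<and> enat q < k" if "coord (T (basis_vec q)) p \<noteq> 0" for p q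
    using T that unfolding mat_alg_def matrix_entry_eq by blast
  note less = enat_less_double[OF _ kl] enat_less_of_double[OF _ kl]
  show ?left
  proof (rule mat_algI)
    show "enat p < l \<and> enat q < l" if "coord ((interleave b o\<^sub>L T) (basis_vec q)) p \<noteq> 0" for p q
      using that entry[of q "p div 2"] less by (auto simp: coord_interleave split: if_splits)
  qed (intro complex_linear_compose complex_linear_interleave lin compact_operator_compose_left cpt)+
  show ?right
  proof (rule mat_algI)
    show "enat p < l \<and> enat q < l" if "coord ((T o\<^sub>L deinterleave b) (basis_vec q)) p \<noteq> 0" for p q
      using that entry[of "q div 2" p] less
      by (auto simp: deinterleave_basis coord_simps split: if_splits)
  qed (intro complex_linear_compose complex_linear_deinterleave lin compact_operator_compose_right cpt)+
  show ?conj
    unfolding conj_interleave_def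
  proof (rule mat_algI)
    show "enat p < l \<and> enat q < l"
      if "coord ((interleave b o\<^sub>L T o\<^sub>L deinterleave b) (basis_vec q)) p \<noteq> 0" for p q
      using that entry[of "q div 2" "p div 2"] less
      by (auto simp: deinterleave_basis coord_interleave coord_simps split: if_splits)
  qed (intro complex_linear_compose complex_linear_interleave complex_linear_deinterleave lin
      compact_operator_compose_right compact_operator_compose_left cpt)+
qed

section \<open>Delaying a slow sequence\<close>

lemma null_delay: "y \<longlonglongrightarrow> l \<Longrightarrow> (\<lambda>i. y (i - K)) \<longlonglongrightarrow> l" for y :: "nat \<Rightarrow> 'a::topological_space"
  by (rule LIMSEQ_offset[of _ K]) simp

text \<open>The truncated difference \<open>i - K\<close> is zero on the first \<open>K\<close> indices, where every slow sequence
  has the entry zero by convention, so the delayed sequence also starts correctly.\<close>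

lemma slow_delay_transform:
  assumes x: "x \<in> carrier (slow_seq \<kappa>)" and G: "bounded_linear G"
    and mem: "\<And>i T. i \<ge> 1 \<Longrightarrow> T \<in> mat_alg (\<kappa> i) \<Longrightarrow> G T \<in> mat_alg (\<kappa> (i + K))"
  shows "(\<lambda>i. G (x (i - K))) \<in> carrier (slow_seq \<kappa>)"
proof -
  have G0: "G 0 = 0" by (rule linear_0[OF bounded_linear.linear[OF G]])
  obtain C where C: "\<And>i. norm (x i) \<le> C" using slow_bound[OF x] by blast
  obtain M where M: "\<And>T. norm (G T) \<le> norm T * M" "M > 0"
    using bounded_linear.pos_bounded[OF G] by blast
  show ?thesis
  proof (rule slow_carrierI)
    show "G (x (0 - K)) = 0" using slow_carrierD(1)[OF x] G0 by simp
    show "norm (G (x (i - K))) \<le> C * M" for i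
      by (meson C M less_imp_le mult_right_mono order_trans)
    show "G (x (i - K)) \<in> mat_alg (\<kappa> i)" if "i \<ge> 1" for i
    proof (cases "i > K")
      case True
      then show ?thesis using mem[of "i - K" "x (i - K)"] slow_carrierD(2)[OF x] by simp
    qed (simp add: slow_carrierD(1)[OF x] G0 mat_alg_zero)
    have "(\<lambda>i. G (x (Suc i) - x i)) \<longlonglongrightarrow> G 0"
      by (rule bounded_linear.tendsto[OF G slow_carrierD(4)[OF x]])
    then have "(\<lambda>i. G (x (Suc i)) - G (x i)) \<longlonglongrightarrow> 0"
      by (simp add: G0 linear_diff[OF bounded_linear.linear[OF G]])
    then show "(\<lambda>i. G (x (Suc i - K)) - G (x (i - K))) \<longlonglongrightarrow> 0"
      by - (rule LIMSEQ_offset[of _ K], simp add: Suc_diff_le)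
  qed
qed

lemma slow_delay_null:
  assumes "x \<in> carrier (slow_seq \<kappa>)"
  shows "(\<lambda>i. x i - x (i - K)) \<longlonglongrightarrow> 0"
proof (induction K)
  case (Suc K)
  have "(\<lambda>i. x (Suc i) - x i) \<longlonglongrightarrow> 0" by (rule slow_carrierD(4)[OF assms])
  then have "(\<lambda>i. x (i - K) - x (i - Suc K)) \<longlonglongrightarrow> 0"
    by - (rule LIMSEQ_offset[of _ "Suc K"], simp)
  then show ?case using Suc by (rule null_diff_trans[rotated])
qed simp

section \<open>The amplification equation\<close>

text \<open>The solution of \<open>2 y i = x i + double (y (i - K - 1))\<close>.  Solving with a delay makes the equation
  an explicit recursion, and leaves room for the doubled matrices at level \<open>i\<close>.\<close>

fun amplify :: "nat \<Rightarrow> (nat \<Rightarrow> ell2 \<Rightarrow>\<^sub>L ell2) \<Rightarrow> nat \<Rightarrow> ell2 \<Rightarrow>\<^sub>L ell2" where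
  "amplify K x 0 = 0"
| "amplify K x (Suc i) = (1 / 2) *\<^sub>R (x (Suc i) + double (amplify K x (i - K)))"

text \<open>Each use of the recursion halves the part of the bound that comes from \<open>C\<close>, at the price of an
  error that is eventually smaller than any given number.\<close>

lemma contraction_tendsto_0:
  fixes \<delta> \<epsilon> :: "nat \<Rightarrow> real"
  assumes nonneg: "\<And>i. 0 \<le> \<delta> i" and bound: "\<And>i. \<delta> i \<le> C" and \<epsilon>: "\<epsilon> \<longlonglongrightarrow> 0"
    and step: "\<And>i. \<delta> (i + K) \<le> \<epsilon> i + \<delta> i / 2"
  shows "\<delta> \<longlonglongrightarrow> 0"
proof (rule LIMSEQ_I)
  fix r :: real assume r: "r > 0"
  \<comment> \<open>The allowance \<open>r / 2\<close> is the fixed point of \<open>s \<mapsto> r / 4 + s / 2\<close>.\<close>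
  have stage: "\<forall>\<^sub>F i in sequentially. \<delta> i \<le> r / 2 + C / 2 ^ n" for n
  proof (induction n)
    case 0
    have "\<delta> i \<le> r / 2 + C / 2 ^ 0" for i using bound[of i] r by simp
    then show ?case by simp
  next
    case (Suc n)
    have "\<forall>\<^sub>F i in sequentially. \<epsilon> i < r / 4" using order_tendstoD(2)[OF \<epsilon>, of "r / 4"] r by simp
    with Suc have "\<forall>\<^sub>F i in sequentially. \<delta> (i + K) \<le> r / 2 + C / 2 ^ Suc n"
    proof eventually_elim
      case (elim i)
      define X where "X = C / 2 ^ n"
      have "\<delta> (i + K) \<le> r / 2 + X / 2"
        using elim step[of i] by (simp flip: X_def)
      then show ?case by (simp add: X_def mult.commute)
    qed
    then show ?case by (rule eventually_sequentially_seg[THEN iffD1])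
  qed
  have "(\<lambda>n. C * (1 / 2) ^ n) \<longlonglongrightarrow> 0" by (intro tendsto_mult_right_zero LIMSEQ_power_zero) simp
  then obtain n where n: "C * (1 / 2) ^ n < r / 2"
    using order_tendstoD(2)[of _ 0 sequentially "r / 2"] r
    by (metis (mono_tags, lifting) eventually_sequentially half_gt_zero order_refl)
  from stage[of n] obtain N where N: "\<And>i. i \<ge> N \<Longrightarrow> \<delta> i \<le> r / 2 + C / 2 ^ n"
    by (auto simp: eventually_sequentially)
  have "C / 2 ^ n < r / 2" using n by (simp add: power_one_over)
  then have "\<delta> i < r" if "i \<ge> N" for i using N[OF that] by linarith
  with nonneg have "\<forall>i\<ge>N. norm (\<delta> i - 0) < r" by simp
  then show "\<exists>no. \<forall>i\<ge>no. norm (\<delta> i - 0) < r" by blast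
qed

text \<open>Doubling is linear and does not increase norms, so the factor one half makes the recursion a
  contraction both for the norms and for the increments.\<close>

lemma amplify_slow:
  assumes x: "x \<in> carrier (slow_seq \<kappa>)" and mono: "mono_on {1..} \<kappa>"
    and dbl: "\<And>i. i \<ge> 1 \<Longrightarrow> \<kappa> i + \<kappa> i \<le> \<kappa> (i + Suc K)"
  shows "amplify K x \<in> carrier (slow_seq \<kappa>)"
proof -
  obtain C where C: "\<And>i. norm (x i) \<le> C" using slow_bound[OF x] by blast
  have "C \<ge> 0" using C norm_ge_zero order_trans by blast
  have bound: "norm (amplify K x i) \<le> C" for i
  proof (induction i rule: less_induct)
    case (less i)
    show ?case
    proof (cases i)
      case (Suc j)
      have "norm (x (Suc j) + double (amplify K x (j - K))) \<le> C + C"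
        using less[of "j - K"] Suc
        by (intro norm_triangle_mono[OF C] order_trans[OF norm_double_le]) simp
      then show ?thesis using Suc by simp
    qed (use \<open>C \<ge> 0\<close> in simp)
  qed
  have mem: "amplify K x i \<in> mat_alg (\<kappa> i)" for i
  proof (induction i rule: less_induct)
    case (less i)
    show ?case
    proof (cases i)
      case (Suc j)
      have "double (amplify K x (j - K)) \<in> mat_alg (\<kappa> (Suc j))"
      proof (cases "j > K")
        case True
        then have le: "\<kappa> (j - K) + \<kappa> (j - K) \<le> \<kappa> (Suc j)" using dbl[of "j - K"] by simp
        have T: "amplify K x (j - K) \<in> mat_alg (\<kappa> (j - K))" using less Suc by simp
        show ?thesis
          unfolding double_def by (intro mat_alg_add interleave_mat_alg(3)[OF T le])
      qed (simp add: double_def conj_interleave_def mat_alg_zero)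
      then show ?thesis using Suc slow_carrierD(2)[OF x]
        by (simp add: mat_alg_scaleR mat_alg_add)
    qed (simp add: mat_alg_zero)
  qed
  show ?thesis
  proof (rule slow_carrierI[OF _ mem bound])
    define \<delta> where "\<delta> i = norm (amplify K x (Suc i) - amplify K x i)" for i
    define \<epsilon> where "\<epsilon> i = norm (x (Suc (i + Suc K)) - x (i + Suc K)) / 2" for i
    have "\<delta> \<longlonglongrightarrow> 0"
    proof (rule contraction_tendsto_0)
      show "0 \<le> \<delta> i" for i by (simp add: \<delta>_def)
      show "\<delta> i \<le> C + C" for i
        unfolding \<delta>_def by (meson bound norm_triangle_ineq4 add_mono order_trans)
      have "(\<lambda>i. norm (x (Suc i) - x i)) \<longlonglongrightarrow> 0" by (rule tendsto_norm_zero[OF slow_carrierD(4)[OF x]])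
      from tendsto_divide_zero[OF LIMSEQ_ignore_initial_segment[OF this, of "Suc K"], of 2]
      show "\<epsilon> \<longlonglongrightarrow> 0" unfolding \<epsilon>_def .
      fix i
      have "amplify K x (Suc (i + Suc K)) =
          (1 / 2) *\<^sub>R (x (Suc (i + Suc K)) + double (amplify K x (Suc i)))"
        using amplify.simps(2)[of K x "i + Suc K"] by (simp add: Suc_diff_le del: amplify.simps)
      moreover have "amplify K x (i + Suc K) = (1 / 2) *\<^sub>R (x (i + Suc K) + double (amplify K x i))"
        using amplify.simps(2)[of K x "i + K"] by (simp del: amplify.simps)
      ultimately have "amplify K x (Suc (i + Suc K)) - amplify K x (i + Suc K) =
          (1 / 2) *\<^sub>R ((x (Suc (i + Suc K)) - x (i + Suc K))
            + double (amplify K x (Suc i) - amplify K x i))"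
        by (simp only: double_diff) (simp add: algebra_simps del: amplify.simps)
      then have "\<delta> (i + Suc K) \<le> (norm (x (Suc (i + Suc K)) - x (i + Suc K))
            + norm (double (amplify K x (Suc i) - amplify K x i))) / 2"
        unfolding \<delta>_def using norm_triangle_ineq by (simp del: amplify.simps add_Suc_right)
      also have "\<dots> \<le> \<epsilon> i + \<delta> i / 2"
        using norm_double_le[of "amplify K x (Suc i) - amplify K x i"]
        by (simp add: \<epsilon>_def \<delta>_def del: amplify.simps)
      finally show "\<delta> (i + Suc K) \<le> \<epsilon> i + \<delta> i / 2" .
    qed
    then show "(\<lambda>i. amplify K x (Suc i) - amplify K x i) \<longlonglongrightarrow> 0"
      unfolding \<delta>_def by (simp only: tendsto_norm_zero_iff)
  qed simp
qed

section \<open>Vanishing of traces under exponential growth\<close>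

lemma exponential_growth_doubling:
  assumes "exponential_growth \<kappa>"
  obtains K where "\<And>i. i \<ge> 1 \<Longrightarrow> \<kappa> i + \<kappa> i \<le> \<kappa> (i + Suc K)"
proof -
  obtain a :: real where a: "a > 1"
    "\<And>i. i \<ge> 1 \<Longrightarrow> ereal a * ereal_of_enat (\<kappa> i) \<le> ereal_of_enat (\<kappa> (i + 1))"
    using assms unfolding exponential_growth_def by blast
  have pow: "ereal (a ^ m) * ereal_of_enat (\<kappa> i) \<le> ereal_of_enat (\<kappa> (i + m))" if "i \<ge> 1" for i m
  proof (induction m)
    case (Suc m)
    have "ereal (a ^ Suc m) * ereal_of_enat (\<kappa> i) = ereal a * (ereal (a ^ m) * ereal_of_enat (\<kappa> i))"
      by (simp add: mult.assoc flip: times_ereal.simps(1))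
    also have "\<dots> \<le> ereal a * ereal_of_enat (\<kappa> (i + m))"
      using Suc a(1) by (intro ereal_mult_left_mono) auto
    also have "\<dots> \<le> ereal_of_enat (\<kappa> (i + Suc m))" using a(2)[of "i + m"] that by simp
    finally show ?case .
  qed (simp flip: one_ereal_def)
  obtain m where m: "2 < a ^ m" using real_arch_pow[OF a(1)] by blast
  then obtain K where K: "m = Suc K" by (cases m) auto
  show ?thesis
  proof
    fix i :: nat assume i: "i \<ge> 1"
    have "ereal 2 * ereal_of_enat (\<kappa> i) \<le> ereal (a ^ m) * ereal_of_enat (\<kappa> i)"
      using m by (intro ereal_mult_right_mono) auto
    also note pow[OF i, of m]
    finally have le: "ereal 2 * ereal_of_enat (\<kappa> i) \<le> ereal_of_enat (\<kappa> (i + m))" .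
    then show "\<kappa> i + \<kappa> i \<le> \<kappa> (i + Suc K)"
      unfolding K[symmetric] by (cases "\<kappa> i"; cases "\<kappa> (i + m)") auto
  qed
qed

text \<open>Replace \<open>x\<close> by \<open>e x\<close> with a slow approximate unit \<open>e\<close>.  With \<open>s\<close> the isometry, the copy
  \<open>s e x s\<^sup>*\<close> is the product of \<open>s e\<close> and \<open>x s\<^sup>*\<close>, which do lie in the algebra after the delay.
  Exchanging them cancels \<open>s\<^sup>* s = 1\<close>, exchanging once more gives \<open>e x\<close> back, and the delay itself
  is invisible modulo null sequences.\<close>

lemma tracial_conj_interleave:
  fixes t :: "(nat \<Rightarrow> ell2 \<Rightarrow>\<^sub>L ell2) \<Rightarrow> 'a"
  assumes mono: "mono_on {1..} \<kappa>"
    and dbl: "\<And>i. i \<ge> 1 \<Longrightarrow> \<kappa> i + \<kappa> i \<le> \<kappa> (i + Suc K)"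
    and comm: "\<And>x y. x \<in> carrier (slow_seq \<kappa>) \<Longrightarrow> y \<in> carrier (slow_seq \<kappa>) \<Longrightarrow>
      t (\<lambda>i. x i o\<^sub>L y i) = t (\<lambda>i. y i o\<^sub>L x i)"
    and null: "\<And>x y. x \<in> carrier (slow_seq \<kappa>) \<Longrightarrow> y \<in> carrier (slow_seq \<kappa>) \<Longrightarrow>
      (\<lambda>i. x i - y i) \<longlonglongrightarrow> 0 \<Longrightarrow> t x = t y"
    and x: "x \<in> carrier (slow_seq \<kappa>)"
  shows "t (\<lambda>i. conj_interleave b (x (i - Suc K))) = t x"
proof -
  obtain e where e: "e \<in> carrier (slow_seq \<kappa>)" "(\<lambda>i. (e i o\<^sub>L x i) - x i) \<longlonglongrightarrow> 0"
    using slow_approx_unit[OF x mono] by blast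
  have grow: "\<kappa> i \<le> \<kappa> (i + Suc K)" if "i \<ge> 1" for i
    by (rule mono_onD[OF mono]) (use that in auto)
  have lin_conj: "bounded_linear (conj_interleave b)"
    unfolding conj_interleave_def
    by (rule bounded_linear_compose[OF bounded_linear_compose_right bounded_linear_compose_left])
  have delay: "(\<lambda>i. y (i - Suc K)) \<in> carrier (slow_seq \<kappa>)" if "y \<in> carrier (slow_seq \<kappa>)" for y
    by (rule slow_delay_transform[OF that bounded_linear_ident]) (use grow mat_alg_mono in blast)
  have conj: "(\<lambda>i. conj_interleave b (y (i - Suc K))) \<in> carrier (slow_seq \<kappa>)"
    if "y \<in> carrier (slow_seq \<kappa>)" for y
    by (rule slow_delay_transform[OF that lin_conj]) (use dbl interleave_mat_alg(3) in blast)
  have left: "(\<lambda>i. interleave b o\<^sub>L e (i - Suc K)) \<in> carrier (slow_seq \<kappa>)"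
    by (rule slow_delay_transform[OF e(1) bounded_linear_compose_left])
       (use dbl interleave_mat_alg(1) in blast)
  have right: "(\<lambda>i. x (i - Suc K) o\<^sub>L deinterleave b) \<in> carrier (slow_seq \<kappa>)"
    by (rule slow_delay_transform[OF x bounded_linear_compose_right])
       (use dbl interleave_mat_alg(2) in blast)
  have ex: "(\<lambda>i. e i o\<^sub>L x i) \<in> carrier (slow_seq \<kappa>)" by (rule slow_mult[OF e(1) x])
  have "t (\<lambda>i. conj_interleave b (x (i - Suc K)))
      = t (\<lambda>i. conj_interleave b (e (i - Suc K) o\<^sub>L x (i - Suc K)))"
  proof (rule null[OF conj[OF x] conj[OF ex]])
    have "(\<lambda>i. conj_interleave b ((x (i - Suc K)) - (e (i - Suc K) o\<^sub>L x (i - Suc K)))) \<longlonglongrightarrow> conj_interleave b 0"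
      by (rule bounded_linear.tendsto[OF lin_conj null_delay[OF null_diff_sym[OF e(2)]]])
    then show "(\<lambda>i. conj_interleave b (x (i - Suc K))
        - conj_interleave b (e (i - Suc K) o\<^sub>L x (i - Suc K))) \<longlonglongrightarrow> 0"
      by (simp add: linear_diff[OF bounded_linear.linear[OF lin_conj]]
          linear_0[OF bounded_linear.linear[OF lin_conj]])
  qed
  also have "\<dots> = t (\<lambda>i. (interleave b o\<^sub>L e (i - Suc K)) o\<^sub>L (x (i - Suc K) o\<^sub>L deinterleave b))"
    by (simp add: conj_interleave_def blinfun_compose_assoc)
  also have "\<dots> = t (\<lambda>i. (x (i - Suc K) o\<^sub>L deinterleave b) o\<^sub>L (interleave b o\<^sub>L e (i - Suc K)))"
    by (rule comm[OF left right])
  also have "\<dots> = t (\<lambda>i. x (i - Suc K) o\<^sub>L e (i - Suc K))"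
  proof -
    have "(S o\<^sub>L deinterleave b) o\<^sub>L (interleave b o\<^sub>L T) = S o\<^sub>L T" for S T :: "ell2 \<Rightarrow>\<^sub>L ell2"
      by (rule blinfun_eqI) (simp add: deinterleave_interleave)
    then show ?thesis by simp
  qed
  also have "\<dots> = t (\<lambda>i. e (i - Suc K) o\<^sub>L x (i - Suc K))"
    by (rule comm[OF delay[OF x] delay[OF e(1)]])
  also have "\<dots> = t (\<lambda>i. x (i - Suc K))"
    by (rule null[OF delay[OF ex] delay[OF x] null_delay[OF e(2)]])
  also have "\<dots> = t x"
    by (rule null[OF delay[OF x] x null_diff_sym[OF slow_delay_null[OF x]]])
  finally show ?thesis .
qed

text \<open>With \<open>y\<close> the solution of the amplification equation, the trace property turns it into
  \<open>2 t y = t x + 2 t y\<close>.\<close>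

lemma additive_tracial_zero:
  fixes t :: "(nat \<Rightarrow> ell2 \<Rightarrow>\<^sub>L ell2) \<Rightarrow> 'a::ab_group_add"
  assumes mono: "mono_on {1..} \<kappa>" and exp: "exponential_growth \<kappa>"
    and add: "\<And>x y. x \<in> carrier (slow_seq \<kappa>) \<Longrightarrow> y \<in> carrier (slow_seq \<kappa>) \<Longrightarrow>
      t (\<lambda>i. x i + y i) = t x + t y"
    and comm: "\<And>x y. x \<in> carrier (slow_seq \<kappa>) \<Longrightarrow> y \<in> carrier (slow_seq \<kappa>) \<Longrightarrow>
      t (\<lambda>i. x i o\<^sub>L y i) = t (\<lambda>i. y i o\<^sub>L x i)"
    and null: "\<And>x y. x \<in> carrier (slow_seq \<kappa>) \<Longrightarrow> y \<in> carrier (slow_seq \<kappa>) \<Longrightarrow>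
      (\<lambda>i. x i - y i) \<longlonglongrightarrow> 0 \<Longrightarrow> t x = t y"
    and x: "x \<in> carrier (slow_seq \<kappa>)"
  shows "t x = 0"
proof -
  obtain K where dbl: "\<And>i. i \<ge> 1 \<Longrightarrow> \<kappa> i + \<kappa> i \<le> \<kappa> (i + Suc K)"
    using exponential_growth_doubling[OF exp] by blast
  define y where "y = amplify K x"
  have y: "y \<in> carrier (slow_seq \<kappa>)" unfolding y_def by (rule amplify_slow[OF x mono dbl])
  define y' where "y' b i = conj_interleave b (y (i - Suc K))" for b i
  have lin: "bounded_linear (conj_interleave b)" for b
    unfolding conj_interleave_def
    by (rule bounded_linear_compose[OF bounded_linear_compose_right bounded_linear_compose_left])
  have y': "y' b \<in> carrier (slow_seq \<kappa>)" for b
    unfolding y'_def by (rule slow_delay_transform[OF y lin]) (use dbl interleave_mat_alg(3) in blast)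
  have ty': "t (y' b) = t y" for b
    unfolding y'_def by (rule tracial_conj_interleave[where t = t and x = y, OF mono dbl comm null y])
  have "y i + y i = x i + (y' False i + y' True i)" for i
  proof (cases i)
    case 0
    then show ?thesis
      by (simp add: y'_def slow_carrierD(1)[OF x] slow_carrierD(1)[OF y] conj_interleave_def)
  next
    case (Suc j)
    have "y i + y i = 2 *\<^sub>R y i" by (simp add: scaleR_2)
    also have "\<dots> = x i + double (y (j - K))" by (simp add: Suc y_def)
    finally show ?thesis by (simp add: double_def y'_def Suc)
  qed
  then have "t (\<lambda>i. y i + y i) = t (\<lambda>i. x i + (y' False i + y' True i))" by simp
  also have "\<dots> = t x + (t y + t y)"
    by (simp add: add[OF x slow_add[OF y' y']] add[OF y' y'] ty')
  finally show "t x = 0" by (simp add: add[OF y y])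
qed

lemma no_trace_exponential_growth:
  assumes "admissible \<kappa>" "exponential_growth \<kappa>" "scalar_trace (slow_quot \<kappa>) \<tau>"
  shows "\<not> nontrivial_map complex_algebra (slow_quot \<kappa>) \<tau>"
proof -
  have mono: "mono_on {1..} \<kappa>" using assms(1) by (simp add: admissible_def)
  have tr_add: "\<tau> (add (slow_quot \<kappa>) X Y) = \<tau> X + \<tau> Y"
    and tr_comm: "\<tau> (mult (slow_quot \<kappa>) X Y) = \<tau> (mult (slow_quot \<kappa>) Y X)"
    if "X \<in> carrier (slow_quot \<kappa>)" "Y \<in> carrier (slow_quot \<kappa>)" for X Y
    using assms(3) that by (auto simp: valued_trace_def complex_algebra_def)
  have "\<tau> (slow_class \<kappa> x) = 0" if x: "x \<in> carrier (slow_seq \<kappa>)" for x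
  proof (rule additive_tracial_zero[OF mono assms(2) _ _ _ x, where t = "\<lambda>x. \<tau> (slow_class \<kappa> x)"])
    fix x y assume xy: "x \<in> carrier (slow_seq \<kappa>)" "y \<in> carrier (slow_seq \<kappa>)"
    then have XY: "slow_class \<kappa> x \<in> carrier (slow_quot \<kappa>)" "slow_class \<kappa> y \<in> carrier (slow_quot \<kappa>)"
      by (auto simp: slow_quot_carrier)
    show "\<tau> (slow_class \<kappa> (\<lambda>i. x i + y i)) = \<tau> (slow_class \<kappa> x) + \<tau> (slow_class \<kappa> y)"
      using tr_add[OF XY] by (simp add: slow_quot_add xy)
    show "\<tau> (slow_class \<kappa> (\<lambda>i. x i o\<^sub>L y i)) = \<tau> (slow_class \<kappa> (\<lambda>i. y i o\<^sub>L x i))"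
      using tr_comm[OF XY] by (simp add: slow_quot_mult xy)
    assume "(\<lambda>i. x i - y i) \<longlonglongrightarrow> 0"
    then show "\<tau> (slow_class \<kappa> x) = \<tau> (slow_class \<kappa> y)"
      using slow_class_eq_iff[OF xy] by simp
  qed
  then show ?thesis
    by (auto simp: nontrivial_map_def slow_quot_carrier complex_algebra_def)
qed

section \<open>Adjoints of matrices\<close>

text \<open>At a finite level the basis expansion is a finite sum, so an operator is determined by finitely
  many matrix entries and the usual matrix computations apply.\<close>

lemma mat_alg_expand:
  assumes T: "T \<in> mat_alg (enat k)"
  shows "blinfun_apply T x = (\<Sum>j<k. scaleC (coord x j) (T (basis_vec j)))"
proof -
  have lin: "complex_linear T" using T by (simp add: mat_alg_def)
  have "T (coord_proj n x) = (\<Sum>j<k. scaleC (coord x j) (T (basis_vec j)))" if "n \<ge> k" for n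
    unfolding complex_linear_coord_proj_expand[OF lin]
    by (rule sum.mono_neutral_right) (use that mat_alg_basis_zero[OF T] in auto)
  then have "(\<lambda>n. T (coord_proj n x)) \<longlonglongrightarrow> (\<Sum>j<k. scaleC (coord x j) (T (basis_vec j)))"
    by (intro tendsto_eventually) (auto simp: eventually_sequentially)
  moreover have "(\<lambda>n. T (coord_proj n x)) \<longlonglongrightarrow> T x"
    by (intro blinfun.tendsto tendsto_const coord_proj_tendsto)
  ultimately show ?thesis by (rule LIMSEQ_unique[rotated])
qed

lemma cinner_left_eqI:
  assumes "\<And>y. cinner x y = cinner x' y" shows "x = x'"
proof (rule ell2_eqI)
  fix n show "coord x n = coord x' n"
    using assms[of "basis_vec n"] by (simp add: cinner_basis_right)
qed

lemma op_adj_eqI: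
  assumes "\<And>x y. cinner (blinfun_apply S x) y = cinner x (blinfun_apply T y)"
  shows "op_adj T = S"
  unfolding op_adj_def
proof (rule the_equality)
  fix R assume "\<forall>x y. cinner (blinfun_apply R x) y = cinner x (blinfun_apply T y)"
  with assms show "R = S" by (intro blinfun_eqI cinner_left_eqI) simp
qed (use assms in simp)

text \<open>The adjoint of a finite matrix is written down as a sum of rank-one operators, one for each
  column.\<close>

lemma op_adj_mat_alg:
  assumes T: "T \<in> mat_alg (enat k)"
  shows "op_adj T \<in> mat_alg (enat k)"
    and "cinner (op_adj T x) y = cinner x (blinfun_apply T y)"
proof -
  define S where "S = (\<Sum>n<k. rank_one (T (basis_vec n)) (basis_vec n))"
  have adj: "cinner (blinfun_apply S x) y = cinner x (blinfun_apply T y)" for x y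
  proof -
    have "cinner (blinfun_apply S x) y = (\<Sum>n<k. coord y n * cinner x (T (basis_vec n)))"
      by (simp add: S_def blinfun_sum_apply rank_one.rep_eq cinner_sum_left cinner_scaleC_left
          cinner_basis_left mult.commute flip: cinner_commute)
    also have "\<dots> = cinner x (blinfun_apply T y)"
      by (subst mat_alg_expand[OF T]) (simp add: cinner_sum_right cinner_scaleC_right)
    finally show ?thesis .
  qed
  have S: "op_adj T = S" by (rule op_adj_eqI[OF adj])
  show "op_adj T \<in> mat_alg (enat k)"
    unfolding S S_def
    by (intro mat_alg_sum rank_one_basis_mat_alg) (use mat_alg_coord_zero[OF T] in auto)
  show "cinner (op_adj T x) y = cinner x (blinfun_apply T y)" by (simp add: S adj)
qed

lemma norm_op_adj_le:
  assumes T: "T \<in> mat_alg (enat k)" shows "norm (op_adj T) \<le> norm T"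
proof (rule norm_blinfun_bound)
  fix x
  let ?y = "op_adj T x"
  have "(norm ?y)\<^sup>2 = inner x (T ?y)"
    using arg_cong[OF op_adj_mat_alg(2)[OF T, of x ?y], of Re]
    by (simp add: power2_norm_eq_inner inner_ell2_def)
  also have "\<dots> \<le> norm x * (norm T * norm ?y)"
    by (meson norm_cauchy_schwarz norm_blinfun mult_left_mono norm_ge_zero order_trans)
  finally have "norm ?y * norm ?y \<le> (norm T * norm x) * norm ?y"
    by (simp add: power2_eq_square algebra_simps)
  then show "norm ?y \<le> norm T * norm x"
    by (metis mult_right_le_imp_le norm_ge_zero mult_nonneg_nonneg order_le_less)
qed simp

lemma op_adj_diff:
  assumes "S \<in> mat_alg (enat k)" "T \<in> mat_alg (enat k)"
  shows "op_adj (S - T) = op_adj S - op_adj T"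
proof (rule op_adj_eqI)
  have diff_left: "cinner (u - v) w = cinner u w - cinner v w"
    and diff_right: "cinner w (u - v) = cinner w u - cinner w v" for u v w
    using cinner_add_left[of "u - v" v w] cinner_add_right[of w "u - v" v] by simp_all
  show "cinner ((op_adj S - op_adj T) x) y = cinner x ((S - T) y)" for x y
    by (simp add: blinfun.diff_left diff_left diff_right assms[THEN op_adj_mat_alg(2)])
qed

lemma slow_op_adj_null:
  assumes fin: "\<And>i. i \<ge> 1 \<Longrightarrow> \<kappa> i \<noteq> \<infinity>"
    and x: "x \<in> carrier (slow_seq \<kappa>)" and y: "y \<in> carrier (slow_seq \<kappa>)"
    and null: "(\<lambda>i. x i - y i) \<longlonglongrightarrow> 0"
  shows "(\<lambda>i. op_adj (x i) - op_adj (y i)) \<longlonglongrightarrow> 0"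
proof (rule Lim_null_comparison[OF _ tendsto_norm_zero[OF null]])
  have "norm (op_adj (x i) - op_adj (y i)) \<le> norm (x i - y i)" if i: "i \<ge> 1" for i
  proof -
    obtain k where k: "\<kappa> i = enat k" using fin[OF i] by auto
    have mem: "x i \<in> mat_alg (enat k)" "y i \<in> mat_alg (enat k)"
      using slow_carrierD(2)[OF x, of i] slow_carrierD(2)[OF y, of i] by (simp_all add: k)
    show ?thesis
      using norm_op_adj_le[OF mat_alg_diff[OF mem]] by (simp add: op_adj_diff[OF mem])
  qed
  then show "\<forall>\<^sub>F i in sequentially. norm (op_adj (x i) - op_adj (y i)) \<le> norm (x i - y i)"
    by (auto simp: eventually_sequentially)
qed

text \<open>Consecutive entries lie in different matrix algebras; monotonicity places both in the larger one,
  where the adjoint is additive and contractive.\<close>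

lemma slow_star:
  assumes mono: "mono_on {1..} \<kappa>" and fin: "\<And>i. i \<ge> 1 \<Longrightarrow> \<kappa> i \<noteq> \<infinity>"
    and x: "x \<in> carrier (slow_seq \<kappa>)"
  shows "(\<lambda>i. op_adj (x i)) \<in> carrier (slow_seq \<kappa>)"
proof -
  obtain C where C: "\<And>i. norm (x i) \<le> C" using slow_bound[OF x] by blast
  have mem: "x i \<in> mat_alg (enat (the_enat (\<kappa> i)))" "\<kappa> i = enat (the_enat (\<kappa> i))" if "i \<ge> 1" for i
    using fin[OF that] slow_carrierD(2)[OF x, of i] by auto
  have zero: "op_adj 0 = 0" by (rule op_adj_eqI) simp
  show ?thesis
  proof (rule slow_carrierI)
    show "op_adj (x 0) = 0" using zero by (simp add: slow_carrierD(1)[OF x])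
    show "op_adj (x i) \<in> mat_alg (\<kappa> i)" if "i \<ge> 1" for i
      using op_adj_mat_alg(1)[OF mem(1)[OF that]] mem(2)[OF that] by simp
    show "norm (op_adj (x i)) \<le> C" for i
    proof (cases "i = 0")
      case False
      then show ?thesis using norm_op_adj_le[OF mem(1)] C order_trans by (metis less_one not_le)
    next
      case True
      then show ?thesis using zero C[of 0] by (simp add: slow_carrierD(1)[OF x])
    qed
    have "norm (op_adj (x (Suc i)) - op_adj (x i)) \<le> norm (x (Suc i) - x i)" if "i \<ge> 1" for i
    proof -
      have "\<kappa> i \<le> \<kappa> (Suc i)" by (rule mono_onD[OF mono]) (use that in auto)
      then have m: "x (Suc i) \<in> mat_alg (enat (the_enat (\<kappa> (Suc i))))"
          "x i \<in> mat_alg (enat (the_enat (\<kappa> (Suc i))))"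
        using mem[of i] mem[of "Suc i"] that mat_alg_mono slow_carrierD(2)[OF x] by auto
      show ?thesis
        using norm_op_adj_le[OF mat_alg_diff[OF m]] by (simp add: op_adj_diff[OF m])
    qed
    then have "\<forall>\<^sub>F i in sequentially.
        norm (op_adj (x (Suc i)) - op_adj (x i)) \<le> norm (x (Suc i) - x i)"
      by (auto simp: eventually_sequentially)
    then show "(\<lambda>i. op_adj (x (Suc i)) - op_adj (x i)) \<longlonglongrightarrow> 0"
      by (rule Lim_null_comparison[OF _ tendsto_norm_zero[OF slow_carrierD(4)[OF x]]])
  qed
qed

lemma slow_quot_star:
  assumes mono: "mono_on {1..} \<kappa>" and fin: "\<And>i. i \<ge> 1 \<Longrightarrow> \<kappa> i \<noteq> \<infinity>"
    and x: "x \<in> carrier (slow_seq \<kappa>)"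
  shows "star (slow_quot \<kappa>) (slow_class \<kappa> x) = slow_class \<kappa> (\<lambda>i. op_adj (x i))"
proof -
  have "slow_class \<kappa> (\<lambda>i. op_adj (x' i)) = slow_class \<kappa> (\<lambda>i. op_adj (x i))"
    if "x' \<in> slow_class \<kappa> x" for x'
    using that x slow_op_adj_null[OF fin _ x, of x']
    by (subst slow_class_eq_iff) (auto simp: slow_class_eq intro!: slow_star mono fin)
  then have "(\<Union>x'\<in>slow_class \<kappa> x. slow_class \<kappa> (\<lambda>i. op_adj (x' i))) = slow_class \<kappa> (\<lambda>i. op_adj (x i))"
    by (rule UN_const_eq[OF slow_class_self[OF x]])
  then show ?thesis by (simp add: slow_quot_def quotient_algebra_def slow_seq_simps)
qed

section \<open>The matrix trace\<close>

definition mat_trace :: "nat \<Rightarrow> (ell2 \<Rightarrow>\<^sub>L ell2) \<Rightarrow> complex" where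
  "mat_trace k T = (\<Sum>j<k. coord (T (basis_vec j)) j)"

lemma mat_trace_add: "mat_trace k (S + T) = mat_trace k S + mat_trace k T"
  by (simp add: mat_trace_def blinfun.add_left coord_simps sum.distrib)

lemma mat_trace_diff: "mat_trace k (S - T) = mat_trace k S - mat_trace k T"
  by (simp add: mat_trace_def blinfun.diff_left coord_simps sum_subtractf)

lemma mat_trace_op_scale: "mat_trace k (op_scale c T) = c * mat_trace k T"
  by (simp add: mat_trace_def op_scale_apply coord_simps sum_distrib_left)

lemma mat_trace_scaleR: "mat_trace k (r *\<^sub>R T) = of_real r * mat_trace k T"
  by (metis mat_trace_op_scale op_scale_of_real)

lemma mat_trace_zero: "mat_trace k 0 = 0"
  by (simp add: mat_trace_def coord_simps)

lemma mat_trace_compose_commute: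
  assumes "S \<in> mat_alg (enat k)" "T \<in> mat_alg (enat k)"
  shows "mat_trace k (S o\<^sub>L T) = mat_trace k (T o\<^sub>L S)"
proof -
  have prod: "mat_trace k (A o\<^sub>L B) =
      (\<Sum>i<k. \<Sum>j<k. coord (B (basis_vec i)) j * coord (A (basis_vec j)) i)"
    if A: "A \<in> mat_alg (enat k)" for A B
    unfolding mat_trace_def
    by (rule sum.cong[OF refl], simp, subst mat_alg_expand[OF A], simp add: coord_sum coord_simps)
  show ?thesis
    unfolding prod[OF assms(1)] prod[OF assms(2)] by (subst sum.swap) (simp add: mult.commute)
qed

lemma norm_mat_trace_le: "cmod (mat_trace k T) \<le> real k * norm T"
proof -
  have "cmod (coord (T (basis_vec j)) j) \<le> norm T" for j
    using cmod_coord_le[of "T (basis_vec j)" j] norm_blinfun[of T "basis_vec j"] by simp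
  then have "cmod (mat_trace k T) \<le> (\<Sum>j<k. norm T)"
    unfolding mat_trace_def by (intro order_trans[OF norm_sum] sum_mono)
  then show ?thesis by simp
qed

lemma mat_trace_adj_compose:
  assumes "T \<in> mat_alg (enat k)"
  shows "mat_trace k (op_adj T o\<^sub>L T) = of_real (\<Sum>j<k. (norm (T (basis_vec j)))\<^sup>2)"
proof -
  have "coord (op_adj T (T (basis_vec j))) j = of_real ((norm (T (basis_vec j)))\<^sup>2)" for j
  proof -
    have "coord (op_adj T (T (basis_vec j))) j = cnj (cinner (op_adj T (T (basis_vec j))) (basis_vec j))"
      by (simp add: cinner_basis_right)
    also have "\<dots> = of_real ((norm (T (basis_vec j)))\<^sup>2)"
      unfolding op_adj_mat_alg(2)[OF assms] cinner_self by simp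
    finally show ?thesis .
  qed
  then show ?thesis by (simp add: mat_trace_def)
qed

text \<open>The unnormalised trace does not depend on the level at which a matrix is viewed.  Hence the
  normalised trace changes between levels only through its denominator.\<close>

lemma mat_trace_enlarge:
  assumes "T \<in> mat_alg (enat k)" "k \<le> l" shows "mat_trace l T = mat_trace k T"
  unfolding mat_trace_def
  by (rule sum.mono_neutral_right) (use assms mat_alg_coord_zero[OF assms(1)] in auto)

lemma mat_trace_coord_proj: "m \<le> k \<Longrightarrow> mat_trace k (coord_proj m) = of_nat m"
proof -
  assume m: "m \<le> k"
  have "mat_trace k (coord_proj m) = mat_trace m (coord_proj m)"
    by (rule mat_trace_enlarge[OF coord_proj_mat_alg m]) simp
  then show ?thesis by (simp add: mat_trace_def coord_coord_proj coord_simps)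
qed

section \<open>Scalar sequences\<close>

text \<open>The copy of the complex numbers that is the matrix algebra of level one.\<close>

definition scalar_op :: "complex \<Rightarrow> (ell2 \<Rightarrow>\<^sub>L ell2)" where
  "scalar_op c = op_scale c (rank_one (basis_vec 0) (basis_vec 0))"

lemma coord_scalar_op: "coord (scalar_op c x) n = (if n = 0 then c * coord x 0 else 0)"
  by (simp add: scalar_op_def op_scale_apply rank_one.rep_eq cinner_basis_left coord_simps)

lemma scalar_op_mat_alg: "scalar_op c \<in> mat_alg 1"
  unfolding scalar_op_def one_enat_def
  by (intro mat_alg_op_scale rank_one_basis_mat_alg) (auto simp: coord_simps)

lemma scalar_op_zero: "scalar_op 0 = 0"
  by (rule blinfun_eqI, rule ell2_eqI) (simp add: coord_scalar_op coord_simps)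

lemma scalar_op_add: "scalar_op (c + d) = scalar_op c + scalar_op d"
  by (rule blinfun_eqI, rule ell2_eqI)
     (simp add: coord_scalar_op coord_simps blinfun.add_left algebra_simps)

lemma scalar_op_diff: "scalar_op (c - d) = scalar_op c - scalar_op d"
  by (rule blinfun_eqI, rule ell2_eqI)
     (simp add: coord_scalar_op coord_simps blinfun.diff_left algebra_simps)

lemma scalar_op_compose: "scalar_op c o\<^sub>L scalar_op d = scalar_op (c * d)"
  by (rule blinfun_eqI, rule ell2_eqI) (simp add: coord_scalar_op)

lemma op_scale_scalar_op: "op_scale c (scalar_op d) = scalar_op (c * d)"
  by (rule blinfun_eqI, rule ell2_eqI) (simp add: coord_scalar_op op_scale_apply coord_simps)

lemma op_adj_scalar_op: "op_adj (scalar_op c) = scalar_op (cnj c)"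
proof (rule op_adj_eqI)
  have "scalar_op c x = scaleC (c * coord x 0) (basis_vec 0)" for c x
    by (rule ell2_eqI) (simp add: coord_scalar_op coord_simps)
  then show "cinner (scalar_op (cnj c) x) y = cinner x (scalar_op c y)" for x y
    by (simp add: cinner_scaleC_left cinner_scaleC_right cinner_basis_left cinner_basis_right)
qed

lemma norm_scalar_op: "norm (scalar_op c) = cmod c"
proof (rule antisym)
  show "norm (scalar_op c) \<le> cmod c"
  proof (rule norm_blinfun_bound)
    fix x
    have "norm (scalar_op c x) \<le> norm (scaleC c x)"
      by (rule norm_ell2_mono) (simp add: coord_scalar_op coord_simps)
    then show "norm (scalar_op c x) \<le> cmod c * norm x" by (simp add: norm_scaleC)
  qed simp
  show "cmod c \<le> norm (scalar_op c)"
    using cmod_coord_le[of "scalar_op c (basis_vec 0)" 0] norm_blinfun[of "scalar_op c" "basis_vec 0"]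
    by (simp add: coord_scalar_op coord_simps)
qed

lemma scalar_op_null_iff: "(\<lambda>i. scalar_op (f i)) \<longlonglongrightarrow> 0 \<longleftrightarrow> f \<longlonglongrightarrow> 0"
  by (simp add: norm_scalar_op flip: tendsto_norm_zero_iff[of f] tendsto_norm_zero_iff[of "\<lambda>i. scalar_op (f i)"])

lemma scalar_seq_slow:
  assumes "f 0 = 0" "\<And>i. cmod (f i) \<le> C" "(\<lambda>i. f (Suc i) - f i) \<longlonglongrightarrow> 0"
  shows "(\<lambda>i. scalar_op (f i)) \<in> carrier (slow_seq (\<lambda>_. 1))"
proof (rule slow_carrierI)
  show "(\<lambda>i. scalar_op (f (Suc i)) - scalar_op (f i)) \<longlonglongrightarrow> 0"
    using assms(3) by (simp add: scalar_op_null_iff flip: scalar_op_diff)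
qed (use assms in \<open>simp_all add: scalar_op_zero norm_scalar_op scalar_op_mat_alg\<close>)

section \<open>The normalised trace under polynomial growth\<close>

text \<open>The growth condition in real numbers; the upper bound makes all levels finite.\<close>

lemma polynomial_growthE:
  assumes "polynomial_growth \<kappa>"
  obtains k :: "nat \<Rightarrow> nat" and C1 C2 p :: real
  where "\<forall>i\<ge>1. \<kappa> i = enat (k i)" "0 < C1" "0 < C2" "0 \<le> p"
    "\<forall>i\<ge>1. C1 * real i powr p \<le> real (k i) \<and> real (k i) \<le> C2 * real i powr p"
    "(\<lambda>i. (real (k (Suc i)) - real (k i)) / real i powr p) \<longlonglongrightarrow> 0"
proof -
  obtain C1 C2 p :: real where C: "0 < C1" "C1 < C2" "1 \<le> p"
    and low: "\<And>i. i \<ge> 1 \<Longrightarrow> ereal (C1 * real i powr p) \<le> ereal_of_enat (\<kappa> i)"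
    and up: "\<And>i. i \<ge> 1 \<Longrightarrow> ereal_of_enat (\<kappa> i) \<le> ereal (C2 * real i powr p)"
    and lim: "(\<lambda>i. (ereal_of_enat (\<kappa> (i + 1)) - ereal_of_enat (\<kappa> i)) / ereal (real i powr p)) \<longlonglongrightarrow> 0"
    using assms unfolding polynomial_growth_def by blast
  define k where "k i = the_enat (\<kappa> i)" for i
  have k: "\<kappa> i = enat (k i)" if "i \<ge> 1" for i
    using up[OF that] unfolding k_def by (cases "\<kappa> i") auto
  have "(\<lambda>i. ereal ((real (k (Suc i)) - real (k i)) / real i powr p)) \<longlonglongrightarrow> ereal 0"
    unfolding zero_ereal_def[symmetric]
  proof (rule Lim_transform_eventually[OF lim])
    have "(ereal_of_enat (\<kappa> (i + 1)) - ereal_of_enat (\<kappa> i)) / ereal (real i powr p)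
        = ereal ((real (k (Suc i)) - real (k i)) / real i powr p)" if "i \<ge> 1" for i
      using that k[of i] k[of "Suc i"] by simp
    then show "\<forall>\<^sub>F i in sequentially.
        (ereal_of_enat (\<kappa> (i + 1)) - ereal_of_enat (\<kappa> i)) / ereal (real i powr p)
        = ereal ((real (k (Suc i)) - real (k i)) / real i powr p)"
      unfolding eventually_sequentially by blast
  qed
  then have "(\<lambda>i. (real (k (Suc i)) - real (k i)) / real i powr p) \<longlonglongrightarrow> 0" by simp
  moreover have "C1 * real i powr p \<le> real (k i)" "real (k i) \<le> C2 * real i powr p" if "i \<ge> 1" for i
    using low[OF that] up[OF that] k[OF that] by simp_all
  ultimately show ?thesis using that[of k C1 C2 p] k C by simp
qed

lemma relative_growth_null:
  fixes k :: "nat \<Rightarrow> nat" and C p :: real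
  assumes "0 < C" "0 \<le> p" "\<And>i. i \<ge> 1 \<Longrightarrow> C * real i powr p \<le> real (k i)"
    and mono: "\<And>i. i \<ge> 1 \<Longrightarrow> k i \<le> k (Suc i)"
    and lim: "(\<lambda>i. (real (k (Suc i)) - real (k i)) / real i powr p) \<longlonglongrightarrow> 0"
  shows "(\<lambda>i. (real (k (Suc i)) - real (k i)) / real (k (Suc i))) \<longlonglongrightarrow> 0"
proof (rule Lim_null_comparison)
  show "(\<lambda>i. (real (k (Suc i)) - real (k i)) / real i powr p / C) \<longlonglongrightarrow> 0"
    using tendsto_divide_zero[OF lim] .
  have "norm ((real (k (Suc i)) - real (k i)) / real (k (Suc i)))
      \<le> (real (k (Suc i)) - real (k i)) / real i powr p / C" if i: "i \<ge> 1" for i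
  proof -
    have pos: "0 < real i powr p * C" using i assms(1) by simp
    have "real i powr p * C \<le> real (k i)" using assms(3)[OF i] by (simp add: mult.commute)
    also have "\<dots> \<le> real (k (Suc i))" using mono[OF i] by simp
    finally have le: "real i powr p * C \<le> real (k (Suc i))" .
    have "0 \<le> real (k (Suc i)) - real (k i)" using mono[OF i] by simp
    then show ?thesis
      using divide_left_mono[OF le] pos le by (simp add: abs_of_nonneg)
  qed
  then show "\<forall>\<^sub>F i in sequentially. norm ((real (k (Suc i)) - real (k i)) / real (k (Suc i)))
      \<le> (real (k (Suc i)) - real (k i)) / real i powr p / C"
    by (auto simp: eventually_sequentially)
qed

definition norm_trace :: "(nat \<Rightarrow> nat) \<Rightarrow> (nat \<Rightarrow> ell2 \<Rightarrow>\<^sub>L ell2) \<Rightarrow> nat \<Rightarrow> complex" where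
  "norm_trace k x i = mat_trace (k i) (x i) / of_nat (k i)"

lemma cmod_norm_trace_le: "cmod (norm_trace k x i) \<le> norm (x i)"
  using norm_mat_trace_le[of "k i" "x i"]
  by (cases "k i = 0") (auto simp: norm_trace_def norm_divide field_simps)

lemma norm_trace_diff: "norm_trace k (\<lambda>i. x i - y i) i = norm_trace k x i - norm_trace k y i"
  by (simp add: norm_trace_def mat_trace_diff diff_divide_distrib)

text \<open>The difference splits into the normalised trace of the increment of \<open>x\<close>, taken at level \<open>i + 1\<close>,
  and the old normalised trace times the relative growth of the level.\<close>

lemma norm_trace_slow:
  assumes k: "\<And>i. i \<ge> 1 \<Longrightarrow> \<kappa> i = enat (k i)" and pos: "\<And>i. i \<ge> 1 \<Longrightarrow> 0 < k i"
    and mono: "\<And>i. i \<ge> 1 \<Longrightarrow> k i \<le> k (Suc i)"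
    and growth: "(\<lambda>i. (real (k (Suc i)) - real (k i)) / real (k (Suc i))) \<longlonglongrightarrow> 0"
    and x: "x \<in> carrier (slow_seq \<kappa>)"
  shows "(\<lambda>i. norm_trace k x (Suc i) - norm_trace k x i) \<longlonglongrightarrow> 0"
proof -
  obtain C where C: "\<And>i. norm (x i) \<le> C" using slow_bound[OF x] by blast
  let ?r = "\<lambda>i. (real (k (Suc i)) - real (k i)) / real (k (Suc i))"
  have lim: "(\<lambda>i. norm (x (Suc i) - x i) + C * ?r i) \<longlonglongrightarrow> 0"
    using tendsto_add[OF tendsto_norm_zero[OF slow_carrierD(4)[OF x]]
        tendsto_mult_right_zero[OF growth, of C]] by simp
  have "norm (norm_trace k x (Suc i) - norm_trace k x i) \<le> norm (x (Suc i) - x i) + C * ?r i"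
    if i: "i \<ge> 1" for i
  proof -
    let ?k = "k i" and ?l = "k (Suc i)"
    have kl: "0 < ?k" "?k \<le> ?l" using pos[OF i] mono[OF i] by auto
    have "mat_trace ?l (x i) = mat_trace ?k (x i)"
      by (rule mat_trace_enlarge[OF _ kl(2)]) (use slow_carrierD(2)[OF x, of i] k[OF i] in simp)
    then have "norm_trace k x (Suc i) - norm_trace k x i =
        mat_trace ?l (x (Suc i) - x i) / of_nat ?l - norm_trace k x i * of_real (?r i)"
      using kl by (simp add: norm_trace_def mat_trace_diff field_simps)
    also have "norm \<dots> \<le> norm (x (Suc i) - x i) + C * ?r i"
    proof (rule order_trans[OF norm_triangle_ineq4 add_mono])
      show "norm (mat_trace ?l (x (Suc i) - x i) / of_nat ?l) \<le> norm (x (Suc i) - x i)"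
        using cmod_norm_trace_le[of "\<lambda>_. ?l" "\<lambda>_. x (Suc i) - x i"] by (simp add: norm_trace_def)
      have r: "0 \<le> ?r i" using kl by simp
      show "norm (norm_trace k x i * of_real (?r i)) \<le> C * ?r i"
        unfolding norm_mult norm_of_real abs_of_nonneg[OF r]
        by (rule mult_right_mono[OF order_trans[OF cmod_norm_trace_le[of k x i] C[of i]] r])
    qed
    finally show ?thesis .
  qed
  then have "\<forall>\<^sub>F i in sequentially.
      norm (norm_trace k x (Suc i) - norm_trace k x i) \<le> norm (x (Suc i) - x i) + C * ?r i"
    by (auto simp: eventually_sequentially)
  then show ?thesis by (rule Lim_null_comparison[OF _ lim])
qed

text \<open>At the harmonic rate the ramp is the arithmetic mean of the unit matrices, so its trace is the mean
  of their sizes.\<close>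

lemma mat_trace_ramp:
  assumes "\<And>j. 1 \<le> j \<Longrightarrow> j \<le> i \<Longrightarrow> n j \<le> l"
  shows "of_nat i * mat_trace l (ramp (\<lambda>i. 1 / (real i + 1)) n i) = of_nat (\<Sum>j=1..i. n j)"
  using assms
proof (induction i)
  case (Suc i)
  let ?R = "ramp (\<lambda>i. 1 / (real i + 1)) n"
  have "mat_trace l (?R (Suc i)) =
      of_real (1 - 1 / (real i + 1)) * mat_trace l (?R i) + of_real (1 / (real i + 1)) * of_nat (n (Suc i))"
    using Suc.prems[of "Suc i"] by (simp add: mat_trace_add mat_trace_scaleR mat_trace_coord_proj)
  then have "of_nat (Suc i) * mat_trace l (?R (Suc i)) =
      of_nat (Suc i) * (of_real (1 - 1 / (real i + 1)) * mat_trace l (?R i)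
        + of_real (1 / (real i + 1)) * of_nat (n (Suc i)))" by (simp only:)
  also have "\<dots> = of_nat i * mat_trace l (?R i) + of_nat (n (Suc i))"
  proof -
    have ne: "of_nat (Suc i) \<noteq> (0::complex)" using of_nat_neq_0 by blast
    have "of_real (1 - 1 / (real i + 1)) = (of_nat i / of_nat (Suc i) :: complex)"
         "of_real (1 / (real i + 1)) = (1 / of_nat (Suc i) :: complex)"
      using ne by (simp_all add: field_simps)
    then show ?thesis using ne by (simp only:) (simp add: distrib_left del: of_nat_Suc)
  qed
  finally show ?case using Suc by simp
qed simp

text \<open>At index \<open>2 m\<close> the levels from \<open>m + 1\<close> to \<open>2 m\<close> make up half of the mean, and each of them has at
  least the size \<open>C1 m\<^sup>p\<close>, against \<open>C2 (2 m)\<^sup>p\<close> for the level \<open>2 m\<close> itself.\<close>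

lemma norm_trace_ramp_not_null:
  fixes k :: "nat \<Rightarrow> nat" and C1 C2 p :: real
  assumes C: "0 < C1" "0 < C2" "0 \<le> p"
    and low: "\<And>i. i \<ge> 1 \<Longrightarrow> C1 * real i powr p \<le> real (k i)"
    and up: "\<And>i. i \<ge> 1 \<Longrightarrow> real (k i) \<le> C2 * real i powr p"
    and mono: "\<And>i j. 1 \<le> i \<Longrightarrow> i \<le> j \<Longrightarrow> k i \<le> k j"
  shows "\<not> norm_trace k (ramp (\<lambda>i. 1 / (real i + 1)) k) \<longlonglongrightarrow> 0"
proof
  let ?R = "ramp (\<lambda>i. 1 / (real i + 1)) k"
  \<comment> \<open>Half of the levels, times the ratio of the two bounds at \<open>m\<close> and at \<open>2 m\<close>.\<close>
  define c where "c = C1 / (2 * (C2 * 2 powr p))"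
  have c: "c > 0" using C by (simp add: c_def)
  assume "norm_trace k ?R \<longlonglongrightarrow> 0"
  then have "\<forall>\<^sub>F i in sequentially. cmod (norm_trace k ?R i) < c"
    using order_tendstoD(2)[OF tendsto_norm_zero c] by blast
  then obtain N where N: "\<And>i. i \<ge> N \<Longrightarrow> cmod (norm_trace k ?R i) < c"
    by (auto simp: eventually_sequentially)
  define m where "m = Suc N"
  have m: "m \<ge> 1" by (simp add: m_def)
  have "real m * (C1 * real m powr p) \<le> (\<Sum>j\<in>{m+1..2*m}. real (k j))"
  proof -
    have "C1 * real m powr p \<le> real (k j)" if "j \<in> {m+1..2*m}" for j
    proof -
      have "C1 * real m powr p \<le> real (k m)" by (rule low[OF m])
      also have "\<dots> \<le> real (k j)" using mono[OF m, of j] that by simp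
      finally show ?thesis .
    qed
    from sum_mono[of "{m+1..2*m}" "\<lambda>_. C1 * real m powr p" "\<lambda>j. real (k j)", OF this]
    show ?thesis by simp
  qed
  also have "\<dots> \<le> (\<Sum>j=1..2*m. real (k j))" by (rule sum_mono2) auto
  finally have sum: "real m * (C1 * real m powr p) \<le> (\<Sum>j=1..2*m. real (k j))" .
  have kpos: "0 < real (k (2*m))"
  proof -
    have "0 < C1 * real (2*m) powr p" using C(1) m by simp
    also have "\<dots> \<le> real (k (2*m))" by (rule low) (use m in simp)
    finally show ?thesis .
  qed
  have "real (2*m) * cmod (mat_trace (k (2*m)) (?R (2*m))) = (\<Sum>j=1..2*m. real (k j))"
  proof -
    have "of_nat (2*m) * mat_trace (k (2*m)) (?R (2*m)) = of_nat (\<Sum>j=1..2*m. k j)"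
      by (rule mat_trace_ramp) (rule mono)
    from arg_cong[OF this, of cmod] show ?thesis
      unfolding norm_mult norm_of_nat by simp
  qed
  then have "real (2*m) * (real (k (2*m)) * cmod (norm_trace k ?R (2*m))) = (\<Sum>j=1..2*m. real (k j))"
    using kpos by (simp add: norm_trace_def norm_divide)
  moreover have "real (2*m) * (real (k (2*m)) * cmod (norm_trace k ?R (2*m)))
      < real (2*m) * (real (k (2*m)) * c)"
    using N[of "2*m"] kpos m by (intro mult_strict_left_mono) (auto simp: m_def)
  moreover have "real (2*m) * (real (k (2*m)) * c) \<le> real (2*m) * ((C2 * real (2*m) powr p) * c)"
    using up[of "2*m"] m c by (intro mult_left_mono mult_right_mono) auto
  moreover have "real (2*m) * ((C2 * real (2*m) powr p) * c) = real m * (C1 * real m powr p)"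
  proof -
    have "real (2*m) powr p = 2 powr p * real m powr p" by (simp add: powr_mult)
    moreover have "2 powr p > 0" by simp
    ultimately show ?thesis using C by (simp add: c_def)
  qed
  ultimately show False using sum by linarith
qed

lemma sqrt_diff_le: "0 \<le> a \<Longrightarrow> 0 \<le> b \<Longrightarrow> \<bar>sqrt a - sqrt b\<bar> \<le> sqrt \<bar>a - b\<bar>"
proof (induction a b rule: linorder_wlog)
  case (le a b)
  have "sqrt b \<le> sqrt (a + (b - a))" by simp
  also have "\<dots> \<le> sqrt a + sqrt (b - a)" using le by (intro sqrt_add_le_add_sqrt) auto
  finally show ?case using le by simp
qed (simp add: abs_minus_commute)

text \<open>On a coset the trace is computed from an arbitrary representative; the choice does not matter
  because the normalised trace is bounded by the norm.  The image of a positive element \<open>y\<^sup>* y\<close> is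
  the square of the scalar sequence of square roots of its normalised traces.\<close>

lemma trace_exists_polynomial_growth:
  assumes adm: "admissible \<kappa>" and poly: "polynomial_growth \<kappa>"
  shows "\<exists>\<tau>. valued_trace (slow_quot (\<lambda>_. 1)) (slow_quot \<kappa>) \<tau> \<and>
    nontrivial_map (slow_quot (\<lambda>_. 1)) (slow_quot \<kappa>) \<tau>"
proof -
  obtain k :: "nat \<Rightarrow> nat" and C1 C2 p :: real
    where levels: "\<forall>i\<ge>1. \<kappa> i = enat (k i)" and C: "0 < C1" "0 < C2" "0 \<le> p"
    and bounds: "\<forall>i\<ge>1. C1 * real i powr p \<le> real (k i) \<and> real (k i) \<le> C2 * real i powr p"
    and incr: "(\<lambda>i. (real (k (Suc i)) - real (k i)) / real i powr p) \<longlonglongrightarrow> 0"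
    by (rule polynomial_growthE[OF poly])
  have k: "\<kappa> i = enat (k i)" and low: "C1 * real i powr p \<le> real (k i)"
    and up: "real (k i) \<le> C2 * real i powr p" if "i \<ge> 1" for i
    using levels bounds that by auto
  have mono_\<kappa>: "mono_on {1..} \<kappa>" and ge1: "\<And>i. i \<ge> 1 \<Longrightarrow> 1 \<le> \<kappa> i"
    using adm by (auto simp: admissible_def)
  have fin: "\<kappa> i \<noteq> \<infinity>" if "i \<ge> 1" for i using k[OF that] by simp
  have k_mono: "k i \<le> k j" if "1 \<le> i" "i \<le> j" for i j
    using mono_onD[OF mono_\<kappa>, of i j] that k[of i] k[of j] by simp
  have k_pos: "0 < k i" if "i \<ge> 1" for i
    using ge1[OF that] k[OF that] by (simp add: one_enat_def)
  have growth: "(\<lambda>i. (real (k (Suc i)) - real (k i)) / real (k (Suc i))) \<longlonglongrightarrow> 0"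
    by (rule relative_growth_null[OF C(1,3) low _ incr]) (auto intro: k_mono)
  let ?Q = "slow_quot (\<lambda>_. 1)" and ?B = "carrier (slow_seq \<kappa>)"
  have mono_1: "mono_on {1..} (\<lambda>_::nat. 1 :: enat)" by (simp add: mono_on_def)
  have fin_1: "(1::enat) \<noteq> \<infinity>" by (simp add: one_enat_def)
  define s where "s x i = scalar_op (norm_trace k x i)" for x i
  have nt_slow: "(\<lambda>i. norm_trace k x (Suc i) - norm_trace k x i) \<longlonglongrightarrow> 0" if "x \<in> ?B" for x
    by (rule norm_trace_slow[OF k k_pos _ growth that]) (auto intro: k_mono)
  have nt_0: "norm_trace k x 0 = 0" if "x \<in> ?B" for x
    by (simp add: norm_trace_def slow_carrierD(1)[OF that] mat_trace_zero)
  have s_slow: "s x \<in> carrier (slow_seq (\<lambda>_. 1))" if x: "x \<in> ?B" for x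
  proof -
    obtain D where "\<And>i. norm (x i) \<le> D" using slow_bound[OF x] by blast
    then have "cmod (norm_trace k x i) \<le> D" for i using cmod_norm_trace_le order_trans by blast
    then show ?thesis
      unfolding s_def by (rule scalar_seq_slow[OF nt_0[OF x] _ nt_slow[OF x]])
  qed
  define \<tau> where "\<tau> X = slow_class (\<lambda>_. 1) (s (SOME x. x \<in> X))" for X
  have \<tau>: "\<tau> (slow_class \<kappa> x) = slow_class (\<lambda>_. 1) (s x)" if x: "x \<in> ?B" for x
  proof -
    have "(SOME x'. x' \<in> slow_class \<kappa> x) \<in> slow_class \<kappa> x"
      by (rule someI[of "\<lambda>x'. x' \<in> slow_class \<kappa> x"]) (rule slow_class_self[OF x])
    then obtain x' where x': "x' = (SOME x'. x' \<in> slow_class \<kappa> x)" "x' \<in> ?B" "(\<lambda>i. x' i - x i) \<longlonglongrightarrow> 0"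
      by (simp add: slow_class_eq[OF x])
    have "(\<lambda>i. norm_trace k (\<lambda>i. x' i - x i) i) \<longlonglongrightarrow> 0"
      by (rule Lim_null_comparison[OF always_eventually tendsto_norm_zero[OF x'(3)]])
         (rule allI, rule order_trans[OF cmod_norm_trace_le], simp)
    then have "(\<lambda>i. scalar_op (norm_trace k x' i - norm_trace k x i)) \<longlonglongrightarrow> 0"
      unfolding scalar_op_null_iff by (simp add: norm_trace_diff)
    then have "(\<lambda>i. s x' i - s x i) \<longlonglongrightarrow> 0" by (simp add: s_def scalar_op_diff)
    then show ?thesis
      unfolding \<tau>_def x'(1)[symmetric] by (simp add: slow_class_eq_iff s_slow x x'(2))
  qed
  have "valued_trace ?Q (slow_quot \<kappa>) \<tau>"
    unfolding valued_trace_def slow_quot_carrier[of \<kappa>]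
  proof (intro conjI ballI allI impI; elim imageE; hypsubst)
    fix x assume x: "x \<in> ?B"
    show "\<tau> (slow_class \<kappa> x) \<in> carrier ?Q" by (simp add: \<tau> x s_slow slow_quot_carrier)
  next
    fix x y assume x: "x \<in> ?B" and y: "y \<in> ?B"
    have "s (\<lambda>i. x i + y i) = (\<lambda>i. s x i + s y i)"
      by (rule ext) (simp add: s_def norm_trace_def mat_trace_add add_divide_distrib scalar_op_add)
    then show "\<tau> (add (slow_quot \<kappa>) (slow_class \<kappa> x) (slow_class \<kappa> y))
        = add ?Q (\<tau> (slow_class \<kappa> x)) (\<tau> (slow_class \<kappa> y))"
      using x y by (simp add: slow_quot_add \<tau> slow_add s_slow)
  next
    fix c x assume x: "x \<in> ?B"
    have "s (\<lambda>i. op_scale c (x i)) = (\<lambda>i. op_scale c (s x i))"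
      by (rule ext) (simp add: s_def norm_trace_def mat_trace_op_scale op_scale_scalar_op)
    then show "\<tau> (scale (slow_quot \<kappa>) c (slow_class \<kappa> x)) = scale ?Q c (\<tau> (slow_class \<kappa> x))"
      using x by (simp add: slow_quot_scale \<tau> slow_op_scale s_slow)
  next
    fix x y assume x: "x \<in> ?B" and y: "y \<in> ?B"
    have "s (\<lambda>i. x i o\<^sub>L y i) = s (\<lambda>i. y i o\<^sub>L x i)"
    proof
      fix i
      show "s (\<lambda>i. x i o\<^sub>L y i) i = s (\<lambda>i. y i o\<^sub>L x i) i"
      proof (cases "i \<ge> 1")
        case True
        have "mat_trace (k i) (x i o\<^sub>L y i) = mat_trace (k i) (y i o\<^sub>L x i)"
          by (rule mat_trace_compose_commute)
             (use slow_carrierD(2)[OF x, of i] slow_carrierD(2)[OF y, of i] k[OF True] in auto)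
        then show ?thesis by (simp add: s_def norm_trace_def)
      next
        case False
        then have "i = 0" by simp
        then show ?thesis by (simp add: s_def norm_trace_def slow_carrierD(1)[OF x] slow_carrierD(1)[OF y])
      qed
    qed
    then show "\<tau> (mult (slow_quot \<kappa>) (slow_class \<kappa> x) (slow_class \<kappa> y))
        = \<tau> (mult (slow_quot \<kappa>) (slow_class \<kappa> y) (slow_class \<kappa> x))"
      using x y by (simp add: slow_quot_mult \<tau> slow_mult)
  next
    fix x assume x: "x \<in> ?B" and pos: "positive_element (slow_quot \<kappa>) (slow_class \<kappa> x)"
    then obtain y where y: "y \<in> ?B"
      and xy: "slow_class \<kappa> x = mult (slow_quot \<kappa>) (star (slow_quot \<kappa>) (slow_class \<kappa> y)) (slow_class \<kappa> y)"
      unfolding positive_element_def slow_quot_carrier by blast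
    define w where "w i = op_adj (y i) o\<^sub>L y i" for i
    have y_star: "(\<lambda>i. op_adj (y i)) \<in> ?B" by (rule slow_star[OF mono_\<kappa> fin y])
    have star_y: "star (slow_quot \<kappa>) (slow_class \<kappa> y) = slow_class \<kappa> (\<lambda>i. op_adj (y i))"
      by (rule slow_quot_star[OF mono_\<kappa> fin y])
    have w: "w \<in> ?B" unfolding w_def by (rule slow_mult[OF y_star y])
    have xw: "slow_class \<kappa> x = slow_class \<kappa> w"
      unfolding xy star_y slow_quot_mult[OF y_star y] w_def ..
    define r where "r i = Re (norm_trace k w i)" for i
    have r: "0 \<le> r i" "norm_trace k w i = of_real (r i)" for i
    proof -
      have "\<exists>q\<ge>0. norm_trace k w i = of_real q"
      proof (cases "i \<ge> 1")
        case True
        have "mat_trace (k i) (w i) = of_real (\<Sum>j<k i. (norm (y i (basis_vec j)))\<^sup>2)"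
          unfolding w_def
          by (rule mat_trace_adj_compose) (use slow_carrierD(2)[OF y, of i] k[OF True] in simp)
        then have "norm_trace k w i = of_real ((\<Sum>j<k i. (norm (y i (basis_vec j)))\<^sup>2) / real (k i))"
          by (simp add: norm_trace_def)
        moreover have "0 \<le> (\<Sum>j<k i. (norm (y i (basis_vec j)))\<^sup>2) / real (k i)"
          by (intro divide_nonneg_nonneg sum_nonneg) auto
        ultimately show ?thesis by blast
      next
        case False
        then have "i = 0" by simp
        then show ?thesis using nt_0[OF w] by (intro exI[of _ 0]) simp
      qed
      then show "0 \<le> r i" "norm_trace k w i = of_real (r i)" by (auto simp: r_def)
    qed
    \<comment> \<open>A self-adjoint square root of the trace of \<open>y\<^sup>* y\<close>.\<close>
    define z where "z i = scalar_op (of_real (sqrt (r i)))" for i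
    have z: "z \<in> carrier (slow_seq (\<lambda>_. 1))"
    proof -
      obtain D where D: "\<And>i. norm (w i) \<le> D" using slow_bound[OF w] by blast
      show ?thesis
        unfolding z_def
      proof (rule scalar_seq_slow)
        show "complex_of_real (sqrt (r 0)) = 0" using nt_0[OF w] by (simp add: r_def)
        show "cmod (complex_of_real (sqrt (r i))) \<le> sqrt D" for i
        proof -
          have "r i \<le> D"
            using order_trans[OF cmod_norm_trace_le[of k w i] D[of i]] r(1)[of i] by (simp add: r(2))
          then show ?thesis using r(1)[of i] by simp
        qed
        have "(\<lambda>i. complex_of_real (r (Suc i) - r i)) \<longlonglongrightarrow> 0"
          using nt_slow[OF w] by (simp add: r(2))
        then have "(\<lambda>i. \<bar>r (Suc i) - r i\<bar>) \<longlonglongrightarrow> 0"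
          using tendsto_norm_zero by (fastforce simp only: norm_of_real)
        from tendsto_real_sqrt[OF this]
        have lim: "(\<lambda>i. sqrt \<bar>r (Suc i) - r i\<bar>) \<longlonglongrightarrow> 0" by simp
        show "(\<lambda>i. complex_of_real (sqrt (r (Suc i))) - complex_of_real (sqrt (r i))) \<longlonglongrightarrow> 0"
        proof (rule Lim_null_comparison[OF always_eventually lim], rule allI)
          fix i
          show "norm (complex_of_real (sqrt (r (Suc i))) - complex_of_real (sqrt (r i)))
              \<le> sqrt \<bar>r (Suc i) - r i\<bar>"
            using sqrt_diff_le[OF r(1) r(1), of "Suc i" i] by (metis norm_of_real of_real_diff)
        qed
      qed
    qed
    have "s w i = op_adj (z i) o\<^sub>L z i" for i
      using r(1)[of i]
      by (simp add: s_def z_def op_adj_scalar_op scalar_op_compose r(2) flip: of_real_mult)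
    then have "s w = (\<lambda>i. op_adj (z i) o\<^sub>L z i)" by blast
    moreover have "(\<lambda>i. op_adj (z i)) \<in> carrier (slow_seq (\<lambda>_. 1))"
      by (rule slow_star[OF mono_1 fin_1 z])
    ultimately have "\<tau> (slow_class \<kappa> x) =
        mult ?Q (star ?Q (slow_class (\<lambda>_. 1) z)) (slow_class (\<lambda>_. 1) z)"
      by (simp add: xw \<tau>[OF w] slow_quot_star[OF mono_1 fin_1 z] slow_quot_mult z)
    then show "positive_element ?Q (\<tau> (slow_class \<kappa> x))"
      unfolding positive_element_def slow_quot_carrier using z by blast
  qed
  moreover have "nontrivial_map ?Q (slow_quot \<kappa>) \<tau>"
  proof -
    let ?R = "ramp (\<lambda>i. 1 / (real i + 1)) k"
    have R: "?R \<in> ?B"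
    proof (rule ramp_slow[OF _ _ _ mono_\<kappa>])
      show "(\<lambda>i. 1 / (real i + 1)) \<longlonglongrightarrow> 0"
        using LIMSEQ_inverse_real_of_nat by (simp add: inverse_eq_divide add.commute)
    qed (use k in auto)
    have "\<not> s ?R \<longlonglongrightarrow> 0"
      unfolding s_def scalar_op_null_iff
      using norm_trace_ramp_not_null[OF C low up k_mono] by simp
    then have "\<tau> (slow_class \<kappa> ?R) \<noteq> zero ?Q"
      unfolding slow_quot_zero \<tau>[OF R] slow_class_eq_iff[OF s_slow[OF R] slow_zero] by simp
    then show ?thesis using R unfolding nontrivial_map_def slow_quot_carrier by blast
  qed
  ultimately show ?thesis by blast
qed

theorem theorem3p1:
  fixes \<kappa>\<^sub>1 \<kappa>\<^sub>2 :: "nat \<Rightarrow> enat"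
  assumes "admissible \<kappa>\<^sub>1" and "polynomial_growth \<kappa>\<^sub>1"
    and "admissible \<kappa>\<^sub>2" and "exponential_growth \<kappa>\<^sub>2"
  shows "(\<exists>\<tau>. valued_trace (slow_quot (\<lambda>_. 1)) (slow_quot \<kappa>\<^sub>1) \<tau> \<and> nontrivial_map (slow_quot (\<lambda>_. 1)) (slow_quot \<kappa>\<^sub>1) \<tau>) \<and>
         \<not> (\<exists>\<tau>. scalar_trace (slow_quot \<kappa>\<^sub>2) \<tau> \<and> nontrivial_map complex_algebra (slow_quot \<kappa>\<^sub>2) \<tau>)"
  using trace_exists_polynomial_growth[OF assms(1,2)] no_trace_exponential_growth[OF assms(3,4)]
  by blast

end
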